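(* Let $L\subset\mathbb{C}$ be a lattice. As $v$ ranges over all primitive vectors of $L$, ordered by Euclidean norm, the signed ratio $\rho(v)$ is uniformly distributed modulo one. Explicitly, for any fixed subinterval $[\alpha,\beta]\subset(-1/2,1/2]$, $$\frac{1}{\#L_{prim}(T)}\,\#\{v\in L_{prim}(T): \alpha<\rho(v)<\beta\}\longrightarrow \beta-\alpha\qquad\text{as } T\to\infty .$$
   Context: A lattice $L\subset\mathbb{C}$ is a discrete subgroup of rank 2, and $|\cdot|$ is the Euclidean norm on $\mathbb{C}$. A vector $v\in L$ is primitive if it can be completed to a $\mathbb{Z}$-basis $\{v,v'\}$ of $L$. $L_{prim}(T)$ is the set of primitive vectors $v\in L$ with $|v|\le T$. For a primitive $v$, consider all $v'\in L$ such that $\{v,v'\}$ is a $\mathbb{Z}$-basis of $L$ that is positively oriented, i.e. $\operatorname{Im}(v'/v)>0$; such a $v'$ is unique up to addition of an integer multiple of $v$. Choose $v'$ among these with $|v'|$ minimal. The signed ratio is $\rho(v):=\pm|v'|/|v|$, with sign $+$ if the angle between $v$ and $v'$ is acute, and $-$ otherwise. If the minimal $v'$ is not unique (which happens for at most finitely many $v$), any choice of minimal $v'$ may be used. *)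

theory Defs
  imports "HOL-Complex_Analysis.Complex_Analysis"
begin

(* The complex numbers as a module over the integers: zmod.subspace means
   "subgroup", zmod.independent and zmod.span are taken with integer coefficients. *)
interpretation zmod: module "\<lambda>(n::int) (z::complex). of_int n * z"
  by unfold_locales (simp_all add: algebra_simps)

definition has_rank :: "complex set \<Rightarrow> nat \<Rightarrow> bool" where
  "has_rank L r \<longleftrightarrow>
     (\<exists>B\<subseteq>L. zmod.independent B \<and> finite B \<and> card B = r) \<and>
     (\<forall>B\<subseteq>L. zmod.independent B \<longrightarrow> finite B \<and> card B \<le> r)"

definition complex_lattice :: "complex set \<Rightarrow> bool" where
  "complex_lattice L \<longleftrightarrow> zmod.subspace L \<and> discrete L \<and> has_rank L 2"

definition is_Z_basis :: "complex set \<Rightarrow> complex \<Rightarrow> complex \<Rightarrow> bool" where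
  "is_Z_basis L v v' \<longleftrightarrow> v \<noteq> v' \<and> zmod.independent {v, v'} \<and> zmod.span {v, v'} = L"

definition primitive_vector :: "complex set \<Rightarrow> complex \<Rightarrow> bool" where
  "primitive_vector L v \<longleftrightarrow> v \<in> L \<and> (\<exists>v'. is_Z_basis L v v')"

definition L_prim :: "complex set \<Rightarrow> real \<Rightarrow> complex set" where
  "L_prim L T = {v. primitive_vector L v \<and> norm v \<le> T}"

definition oriented_completion :: "complex set \<Rightarrow> complex \<Rightarrow> complex \<Rightarrow> bool" where
  "oriented_completion L v v' \<longleftrightarrow> v' \<in> L \<and> is_Z_basis L v v' \<and> Im (v' / v) > 0"

definition minimal_completion :: "complex set \<Rightarrow> complex \<Rightarrow> complex \<Rightarrow> bool" where
  "minimal_completion L v v' \<longleftrightarrow> is_arg_min norm (oriented_completion L v) v'"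

(* For nonzero v and v', the unsigned angle between them is the absolute value of
   the principal argument of v' / v. A right angle gets the sign -. *)
definition signed_ratio :: "complex \<Rightarrow> complex \<Rightarrow> real" where
  "signed_ratio v v' =
     (if \<bar>Arg (v' / v)\<bar> < pi / 2 then norm v' / norm v else - (norm v' / norm v))"

(* Vectors are counted, not values: coinciding values of f count with multiplicity.
   Ordering by norm means taking all primitive vectors of norm at most T, T \<longrightarrow> \<infinity>. *)
definition uniformly_distributed_mod_1 :: "complex set \<Rightarrow> (complex \<Rightarrow> real) \<Rightarrow> bool" where
  "uniformly_distributed_mod_1 L f \<longleftrightarrow>
     (\<forall>a b. 0 \<le> a \<and> a < b \<and> b \<le> 1 \<longrightarrow>
        ((\<lambda>T. real (card {v \<in> L_prim L T. a \<le> frac (f v) \<and> frac (f v) < b})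
               / real (card (L_prim L T))) \<longlongrightarrow> b - a) at_top)"

end

theory Submission
  imports Defs "HOL-Number_Theory.Number_Theory" "HOL-Real_Asymp.Real_Asymp"
begin

text \<open>
  Fix a positively oriented basis \<open>w1, w2\<close> of \<open>L\<close>. A primitive vector is \<open>v = a w1 + b w2\<close> with
  \<open>a, b\<close> coprime, its oriented completions are the \<open>v' = c w1 + d w2\<close> with \<open>a d - b c = 1\<close>, and
  \<open>a v' - c v = w2\<close> gives
  \[ v'/v = c/a + w_2/(a v) . \]
  The imaginary part of \<open>v'/v\<close> is the covolume divided by \<open>|v|^2\<close>, and minimality of \<open>v'\<close> forces
  \<open>|Re (v'/v)| \<le> 1/2\<close>. Hence, as \<open>|v|\<close> grows, \<open>\<rho>(v)\<close> differs by \<open>o(1)\<close> from \<open>Re (v'/v)\<close>, and so from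
  \<open>c/a\<close>, where \<open>c\<close> is minus an inverse of \<open>b\<close> modulo \<open>a\<close>. Only the finitely many \<open>v\<close> with \<open>a = 0\<close> escape.

  By Weyl's criterion it is therefore enough that, for each fixed \<open>k \<ge> 1\<close>, the sum of the exponentials of
  \<open>k c/a\<close> over the primitive vectors of norm at most \<open>T\<close> is \<open>o(T^2)\<close>, since there are at least a constant times
  \<open>T^2\<close> such vectors (\<open>card_L_prim_ge\<close>). For fixed \<open>a\<close> the admissible \<open>b\<close> fill an interval because a
  disc is convex, so the inner sum is an incomplete Kloosterman sum modulo \<open>|a|\<close>. Every saving of a power of the modulus,
  on average over the modulus, is good enough, so Weil's bound can be replaced by an elementary argument:

  \<^item> Kloosterman's fourth moment method, carried out for an arbitrary modulus \<open>q\<close>. Multiplying the summation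
    variable by a unit \<open>u\<close> shows that \<open>K(h, n) = K(h u, n / u)\<close>. So the fourth power of a single sum occurs about
    \<open>\<phi>(q)\<close> times in the complete fourth moment, which by orthogonality counts the solutions of
    \<open>x1 + x2 = x3 + x4\<close>, \<open>1/x1 + 1/x2 = 1/x3 + 1/x4\<close> modulo \<open>q\<close>. Those satisfy
    \<open>q dvd (x1 + x2) (x1 - x4) (x2 - x4)\<close>, whence one of the three factors shares with \<open>q\<close> a divisor of size at
    least the cube root of \<open>q\<close>; such triples are rare. The result is \<open>kloosterman_bound\<close>, which saves
    \<open>q^(1/12)\<close> up to the number of divisors of \<open>q\<close>.

  \<^item> Incomplete sums are treated by averaging over translates of the interval by \<open>t < H\<close>: this costs \<open>O(H)\<close>, and the
    mean square of the short window sums is controlled by the complete sums through Parseval's identity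
    (\<open>norm_incomplete_sum_le\<close>).

  \<^item> Summing over the moduli \<open>q \<le> M\<close> uses only that the number of divisors of \<open>q\<close> is \<open>O(log M)\<close> on average
    (\<open>inverse_char_sums_average\<close>).

  Weyl's criterion is obtained by comparing the points with the vertices of a regular polygon with
  more and more vertices, first for polynomials and then, by the Stone-Weierstrass theorem, for continuous test functions
  on the circle. Only upper bounds for the proportion of points in an arc are proved; the complementary arc yields the
  lower bounds (\<open>proportion_tendsto\<close>). In this form a set which agrees with an arc only up to finitely many points and
  up to \<open>\<epsilon>\<close> can be treated as well. This is needed because \<open>\<rho>(v)\<close> may leave \<open>[-1/2, 1/2]\<close> slightly, so that
  near the end points \<open>\<rho>(v)\<close> and its residue modulo one describe different sets.
\<close>

section \<open>Characters of the circle and of the integers modulo a number\<close>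

definition circ :: "real \<Rightarrow> complex" where
  "circ x = cis (2 * pi * x)"

lemma norm_circ [simp]: "norm (circ x) = 1"
  by (simp add: circ_def)

lemma circ_add_int [simp]: "circ (x + of_int k) = circ x"
  by (simp add: circ_def distrib_left cis_mult[symmetric])

lemma circ_power: "circ x ^ k = circ (real k * x)"
  using Complex.DeMoivre[of "2 * pi * x" k] by (simp add: circ_def mult.left_commute)

lemma circ_eq_iff: "circ x = circ y \<longleftrightarrow> (\<exists>n::int. x = y + of_int n)"
proof
  assume "circ x = circ y"
  hence "exp (\<i> * complex_of_real (2 * pi * x)) = exp (\<i> * complex_of_real (2 * pi * y))"
    by (simp add: circ_def cis_conv_exp)
  then obtain n :: int where "\<i> * complex_of_real (2 * pi * x) = \<i> * complex_of_real (2 * pi * y) + of_int (2 * n) * of_real pi * \<i>"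
    unfolding exp_eq by auto
  hence "Im (\<i> * complex_of_real (2 * pi * x)) = Im (\<i> * complex_of_real (2 * pi * y) + of_int (2 * n) * of_real pi * \<i>)"
    by simp
  hence "2 * pi * x = 2 * pi * (y + of_int n)" by (simp add: algebra_simps)
  thus "\<exists>n::int. x = y + of_int n" by auto
qed auto

text \<open>
  The constant is the speed of the parametrisation; this is what allows the points to be perturbed in the
  Weyl sums.
\<close>

lemma norm_circ_diff_le: "norm (circ x - circ y) \<le> 2 * pi * \<bar>x - y\<bar>"
proof -
  have "circ x = exp (\<i> * of_real (2 * pi * (x - y))) * circ y"
    unfolding cis_conv_exp[symmetric] circ_def cis_mult by (simp add: right_diff_distrib)
  hence "circ x - circ y = (exp (\<i> * of_real (2 * pi * (x - y))) - 1) * circ y"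
    by (simp add: algebra_simps)
  hence "norm (circ x - circ y) = 2 * \<bar>sin (2 * pi * (x - y) / 2)\<bar>"
    by (simp only: norm_mult norm_circ dist_exp_i_1 mult_1_right)
  also have "\<dots> \<le> 2 * \<bar>2 * pi * (x - y) / 2\<bar>" by (intro mult_left_mono abs_sin_x_le_abs_x) auto
  finally show ?thesis by (simp add: abs_mult)
qed

text \<open>
  The additive character \<open>r \<mapsto> e(r/q)\<close> of the integers modulo \<open>q\<close>.
\<close>

definition chi :: "int \<Rightarrow> int \<Rightarrow> complex" where
  "chi q r = circ (of_int r / of_int q)"

lemma norm_chi [simp]: "norm (chi q r) = 1"
  by (simp add: chi_def circ_def)

lemma chi_0 [simp]: "chi q 0 = 1"
  by (simp add: chi_def circ_def)

lemma chi_add: "chi q (r + s) = chi q r * chi q s"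
  by (simp add: chi_def circ_def cis_mult add_divide_distrib distrib_left)

lemma cnj_chi: "cnj (chi q r) = chi q (- r)"
  by (simp add: chi_def circ_def cis_cnj)

lemma chi_mult_cnj: "chi q r * cnj (chi q s) = chi q (r - s)"
  using chi_add[of q r "- s"] by (simp add: cnj_chi)

lemma chi_multiple [simp]: "chi q (q * k) = 1"
  by (cases "q = 0") (simp_all add: chi_def circ_def)

lemma chi_cong:
  assumes "[r = s] (mod q)"
  shows "chi q r = chi q s"
proof -
  obtain k where "s = r + q * k"
    using assms by (auto simp: cong_iff_lin)
  thus ?thesis by (simp add: chi_add)
qed

lemma chi_eq_1_iff:
  assumes "q > 0"
  shows "chi q r = 1 \<longleftrightarrow> q dvd r"
proof
  assume "chi q r = 1"
  hence "exp (\<i> * complex_of_real (2 * pi * (of_int r / of_int q))) = 1"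
    by (simp add: chi_def circ_def cis_conv_exp)
  then obtain n :: int where "2 * pi * (of_int r / of_int q) = of_int (2 * n) * pi"
    unfolding exp_eq_1 by auto
  hence "(of_int r :: real) = of_int n * of_int q"
    using assms by (simp add: field_simps)
  hence "r = n * q" by (metis of_int_eq_iff of_int_mult)
  thus "q dvd r" by simp
qed auto

text \<open>
  Shifting the summation variable by one multiplies the sum by \<open>chi q r\<close>, so the sum vanishes
  unless this factor is one.
\<close>

lemma chi_orthogonality:
  assumes "q > 0"
  shows "(\<Sum>h\<in>{0..<q}. chi q (h * r)) = (if q dvd r then of_int q else 0)"
proof (cases "q dvd r")
  case True
  hence "chi q (h * r) = 1" for h
    using chi_eq_1_iff[OF assms] by simp
  thus ?thesis using True assms by simp
next
  case False
  let ?S = "\<Sum>h\<in>{0..<q}. chi q (h * r)"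
  have bij: "bij_betw (\<lambda>h. (h + 1) mod q) {0..<q} {0..<q}"
    by (rule bij_betwI[of _ _ _ "\<lambda>h. (h - 1) mod q"]) (use assms in \<open>auto simp: mod_simps\<close>)
  have "?S = (\<Sum>h\<in>{0..<q}. chi q ((h + 1) mod q * r))"
    by (rule sum.reindex_bij_betw[OF bij, symmetric])
  also have "\<dots> = (\<Sum>h\<in>{0..<q}. chi q (h * r) * chi q r)"
  proof (rule sum.cong[OF refl])
    fix h
    have "[(h + 1) mod q * r = h * r + r] (mod q)"
      by (simp add: Cong.cong_def mod_simps algebra_simps)
    thus "chi q ((h + 1) mod q * r) = chi q (h * r) * chi q r"
      using chi_cong chi_add by metis
  qed
  also have "\<dots> = ?S * chi q r" by (simp add: sum_distrib_right)
  finally have "?S * (chi q r - 1) = 0" by (simp add: algebra_simps)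
  thus ?thesis using False chi_eq_1_iff[OF assms] by simp
qed

lemma parseval:
  assumes "q > 0"
  shows "(\<Sum>h\<in>{0..<q}. (norm (\<Sum>s\<in>{0..<q}. c s * chi q (h * s)))\<^sup>2) = of_int q * (\<Sum>s\<in>{0..<q}. (norm (c s))\<^sup>2)"
proof -
  let ?I = "{0..<q}"
  have "complex_of_real (\<Sum>h\<in>?I. (norm (\<Sum>s\<in>?I. c s * chi q (h * s)))\<^sup>2) =
      (\<Sum>h\<in>?I. (\<Sum>s\<in>?I. c s * chi q (h * s)) * cnj (\<Sum>t\<in>?I. c t * chi q (h * t)))"
    by (simp only: of_real_sum complex_norm_square)
  also have "\<dots> = (\<Sum>h\<in>?I. \<Sum>s\<in>?I. \<Sum>t\<in>?I. (c s * cnj (c t)) * chi q (h * (s - t)))"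
    by (simp add: sum_product chi_mult_cnj[symmetric] right_diff_distrib mult_ac)
  also have "\<dots> = (\<Sum>s\<in>?I. \<Sum>h\<in>?I. \<Sum>t\<in>?I. (c s * cnj (c t)) * chi q (h * (s - t)))"
    by (rule sum.swap)
  also have "\<dots> = (\<Sum>s\<in>?I. \<Sum>t\<in>?I. \<Sum>h\<in>?I. (c s * cnj (c t)) * chi q (h * (s - t)))"
    by (rule sum.cong[OF refl], rule sum.swap)
  also have "\<dots> = (\<Sum>s\<in>?I. \<Sum>t\<in>?I. (c s * cnj (c t)) * (if q dvd s - t then of_int q else 0))"
    by (simp only: sum_distrib_left[symmetric] chi_orthogonality[OF assms])
  also have "\<dots> = (\<Sum>s\<in>?I. \<Sum>t\<in>?I. if t = s then c s * cnj (c s) * of_int q else 0)"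
  proof (intro sum.cong refl)
    fix s t assume "s \<in> ?I" "t \<in> ?I"
    hence "q dvd s - t \<longleftrightarrow> t = s"
      by (auto simp: mod_eq_dvd_iff[symmetric])
    thus "(c s * cnj (c t)) * (if q dvd s - t then of_int q else 0) =
        (if t = s then c s * cnj (c s) * of_int q else 0)" by simp
  qed
  also have "\<dots> = (\<Sum>s\<in>?I. c s * cnj (c s) * of_int q)"
    by (intro sum.cong) (simp_all add: sum.delta)
  also have "\<dots> = complex_of_real (of_int q * (\<Sum>s\<in>?I. (norm (c s))\<^sup>2))"
    by (simp only: of_real_mult of_real_sum complex_norm_square sum_distrib_left of_real_of_int_eq mult.commute)
  finally show ?thesis by (simp only: of_real_eq_iff)
qed

text \<open>
  The second moment over all pairs of frequencies counts coincidences of the two phases. With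
  \<open>W\<close> the set of pairs of units it becomes a fourth moment of Kloosterman sums.
\<close>

lemma parseval_2d:
  fixes \<phi> \<psi> :: "'a \<Rightarrow> int"
  assumes "q > 0" "finite W"
  shows "(\<Sum>h\<in>{0..<q}. \<Sum>k\<in>{0..<q}. (norm (\<Sum>w\<in>W. chi q (h * \<phi> w + k * \<psi> w)))\<^sup>2) =
     (of_int q)\<^sup>2 * real (card {(w, w'). w \<in> W \<and> w' \<in> W \<and> q dvd \<phi> w - \<phi> w' \<and> q dvd \<psi> w - \<psi> w'})"
proof -
  let ?I = "{0..<q}"
  have expand: "complex_of_real ((norm (\<Sum>w\<in>W. chi q (h * \<phi> w + k * \<psi> w)))\<^sup>2) =
      (\<Sum>(w, w')\<in>W \<times> W. chi q (h * (\<phi> w - \<phi> w')) * chi q (k * (\<psi> w - \<psi> w')))" for h k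
  proof -
    have "complex_of_real ((norm (\<Sum>w\<in>W. chi q (h * \<phi> w + k * \<psi> w)))\<^sup>2) =
       (\<Sum>w\<in>W. chi q (h * \<phi> w + k * \<psi> w)) * cnj (\<Sum>w\<in>W. chi q (h * \<phi> w + k * \<psi> w))"
      by (simp only: complex_norm_square)
    also have "\<dots> = (\<Sum>(w, w')\<in>W \<times> W. chi q (h * \<phi> w + k * \<psi> w) * cnj (chi q (h * \<phi> w' + k * \<psi> w')))"
      by (simp add: sum_product sum.cartesian_product)
    also have "\<dots> = (\<Sum>(w, w')\<in>W \<times> W. chi q (h * (\<phi> w - \<phi> w')) * chi q (k * (\<psi> w - \<psi> w')))"
      by (intro sum.cong refl)
         (auto simp: chi_mult_cnj chi_add[symmetric] algebra_simps)
    finally show ?thesis .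
  qed
  have "complex_of_real (\<Sum>h\<in>?I. \<Sum>k\<in>?I. (norm (\<Sum>w\<in>W. chi q (h * \<phi> w + k * \<psi> w)))\<^sup>2) =
     (\<Sum>h\<in>?I. \<Sum>k\<in>?I. \<Sum>(w, w')\<in>W \<times> W. chi q (h * (\<phi> w - \<phi> w')) * chi q (k * (\<psi> w - \<psi> w')))"
    by (simp only: of_real_sum expand)
  also have "\<dots> = (\<Sum>h\<in>?I. \<Sum>(w, w')\<in>W \<times> W. \<Sum>k\<in>?I. chi q (h * (\<phi> w - \<phi> w')) * chi q (k * (\<psi> w - \<psi> w')))"
    by (rule sum.cong[OF refl], subst sum.swap) (simp add: case_prod_unfold)
  also have "\<dots> = (\<Sum>(w, w')\<in>W \<times> W. \<Sum>h\<in>?I. \<Sum>k\<in>?I. chi q (h * (\<phi> w - \<phi> w')) * chi q (k * (\<psi> w - \<psi> w')))"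
    by (subst sum.swap) (simp add: case_prod_unfold)
  also have "\<dots> = (\<Sum>(w, w')\<in>W \<times> W.
      (if q dvd \<phi> w - \<phi> w' then of_int q else 0) * (if q dvd \<psi> w - \<psi> w' then of_int q else 0))"
    by (simp only: sum_product[symmetric] chi_orthogonality[OF assms(1)])
  also have "\<dots> = (\<Sum>p\<in>W \<times> W. if q dvd \<phi> (fst p) - \<phi> (snd p) \<and> q dvd \<psi> (fst p) - \<psi> (snd p)
       then (of_int q)\<^sup>2 else 0)"
    by (intro sum.cong refl) (auto simp: power2_eq_square)
  also have "\<dots> = (of_int q)\<^sup>2 * of_nat (card ({p \<in> W \<times> W. q dvd \<phi> (fst p) - \<phi> (snd p) \<and> q dvd \<psi> (fst p) - \<psi> (snd p)}))"
    using assms(2) by (simp add: sum.inter_filter[symmetric] mult.commute)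
  also have "{p \<in> W \<times> W. q dvd \<phi> (fst p) - \<phi> (snd p) \<and> q dvd \<psi> (fst p) - \<psi> (snd p)} =
     {(w, w'). w \<in> W \<and> w' \<in> W \<and> q dvd \<phi> w - \<phi> w' \<and> q dvd \<psi> w - \<psi> w'}" by auto
  finally have "complex_of_real (\<Sum>h\<in>?I. \<Sum>k\<in>?I. (norm (\<Sum>w\<in>W. chi q (h * \<phi> w + k * \<psi> w)))\<^sup>2) =
    complex_of_real ((of_int q)\<^sup>2 * real (card {(w, w'). w \<in> W \<and> w' \<in> W \<and> q dvd \<phi> w - \<phi> w' \<and> q dvd \<psi> w - \<psi> w'}))"
    by simp
  thus ?thesis by (simp only: of_real_eq_iff)
qed

section \<open>Kloosterman sums\<close>

definition units_mod :: "int \<Rightarrow> int set" where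
  "units_mod q = {x \<in> {0..<q}. coprime x q}"

definition kloosterman :: "int \<Rightarrow> int \<Rightarrow> int \<Rightarrow> complex" where
  "kloosterman q h n = (\<Sum>x\<in>units_mod q. chi q (h * x + n * modular_inverse q x))"

definition divisors :: "int \<Rightarrow> int set" where
  "divisors q = {d \<in> {1..q}. d dvd q}"

lemma finite_int_interval_filter [simp]: "finite {x :: int. a \<le> x \<and> x < b \<and> P x}"
  by (rule finite_subset[of _ "{a..<b}"]) auto

lemma int_div_less_of_less_mult:
  fixes x d m :: int
  assumes "d > 0" "x < d * m"
  shows "x div d < m"
proof -
  have "d * (x div d) \<le> x" using assms(1) by (simp add: minus_mod_eq_mult_div [symmetric])
  also note assms(2)
  finally show ?thesis using assms(1) by simp
qed

lemma finite_units_mod [simp]: "finite (units_mod q)"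
  unfolding units_mod_def by (rule finite_subset[of _ "{0..<q}"]) auto

lemma units_modD: "x \<in> units_mod q \<Longrightarrow> coprime x q" "x \<in> units_mod q \<Longrightarrow> x \<in> {0..<q}"
  by (simp_all add: units_mod_def)

lemma card_units_mod_pos: "q > 0 \<Longrightarrow> card (units_mod q) > 0"
proof -
  assume q: "q > 0"
  have "1 mod q \<in> units_mod q" using q by (simp add: units_mod_def)
  thus ?thesis by (metis card_gt_0_iff empty_iff finite_units_mod)
qed

text \<open>
  Inverses are only ever used modulo \<open>q\<close>; this identifies the normalised inverse with any other
  one.
\<close>

lemma modular_inverse_cong_unique:
  fixes y z q :: int
  assumes "[y * z = 1] (mod q)"
  shows "[modular_inverse q y = z] (mod q)"
proof -
  have cop: "coprime y q" using assms by (metis coprime_iff_invertible_int)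
  have "[modular_inverse q y * (y * z) = modular_inverse q y * 1] (mod q)"
    by (intro cong_mult assms cong_refl)
  moreover have "[modular_inverse q y * y * z = 1 * z] (mod q)"
    by (intro cong_mult cong_modular_inverse2 cop cong_refl)
  ultimately show ?thesis by (simp add: mult.assoc) (metis cong_sym cong_trans)
qed

lemma inj_on_modular_inverse: "inj_on (modular_inverse q) (units_mod q)"
proof (rule inj_onI)
  fix x y assume xy: "x \<in> units_mod q" "y \<in> units_mod q" and eq: "modular_inverse q x = modular_inverse q y"
  have "[x * (modular_inverse q y * y) = x * 1] (mod q)"
    using xy by (intro cong_mult cong_modular_inverse2 units_modD cong_refl)
  moreover have "[(x * modular_inverse q x) * y = 1 * y] (mod q)"
    using xy by (intro cong_mult cong_modular_inverse1 units_modD cong_refl)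
  ultimately have "[x = y] (mod q)"
    using eq by (simp add: mult.assoc) (metis cong_sym cong_trans)
  thus "x = y" using xy by (auto simp: units_mod_def Cong.cong_def)
qed

lemma bij_betw_units_mod_mult:
  assumes "q > 0" "coprime u q"
  shows "bij_betw (\<lambda>x. u * x mod q) (units_mod q) (units_mod q)"
proof -
  have "inj_on (\<lambda>x. u * x mod q) (units_mod q)"
  proof (rule inj_onI)
    fix x y assume xy: "x \<in> units_mod q" "y \<in> units_mod q" and "u * x mod q = u * y mod q"
    hence "[x = y] (mod q)"
      using assms cong_mult_lcancel by (metis Cong.cong_def)
    thus "x = y" using xy by (auto simp: units_mod_def Cong.cong_def)
  qed
  moreover have "(\<lambda>x. u * x mod q) ` units_mod q \<subseteq> units_mod q"
    using assms by (auto simp: units_mod_def)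
  ultimately show ?thesis
    by (simp add: bij_betw_def endo_inj_surj)
qed

lemma kloosterman_mod: "kloosterman q (h mod q) (k mod q) = kloosterman q h k"
  unfolding kloosterman_def
  by (intro sum.cong refl chi_cong cong_add cong_mult cong_refl) (simp_all add: Cong.cong_def)

text \<open>
  Substitute \<open>u x\<close> for \<open>x\<close>: this is the symmetry that makes a single Kloosterman
  sum reappear at many frequencies.
\<close>

lemma kloosterman_scale:
  assumes "q > 0" "coprime u q"
  shows "kloosterman q (h * u) (n * modular_inverse q u) = kloosterman q h n"
proof -
  have "kloosterman q h n =
      (\<Sum>x\<in>units_mod q. chi q (h * (u * x mod q) + n * modular_inverse q (u * x mod q)))"
    unfolding kloosterman_def by (rule sum.reindex_bij_betw[OF bij_betw_units_mod_mult[OF assms], symmetric])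
  also have "\<dots> = kloosterman q (h * u) (n * modular_inverse q u)"
    unfolding kloosterman_def
  proof (intro sum.cong refl chi_cong)
    fix x assume x: "x \<in> units_mod q"
    have "[(u * x mod q) * (modular_inverse q u * modular_inverse q x) =
        (u * x) * (modular_inverse q u * modular_inverse q x)] (mod q)"
      by (intro cong_mult cong_refl) (simp add: Cong.cong_def)
    also have "(u * x) * (modular_inverse q u * modular_inverse q x) =
        (u * modular_inverse q u) * (x * modular_inverse q x)" by (simp add: mult_ac)
    also have "[\<dots> = 1 * 1] (mod q)"
      by (intro cong_mult cong_modular_inverse1 assms units_modD x)
    finally have "[modular_inverse q (u * x mod q) = modular_inverse q u * modular_inverse q x] (mod q)"
      by (intro modular_inverse_cong_unique) simp
    hence "[n * modular_inverse q (u * x mod q) = n * (modular_inverse q u * modular_inverse q x)] (mod q)"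
      by (intro cong_mult cong_refl)
    moreover have "[h * (u * x mod q) = h * (u * x)] (mod q)"
      by (intro cong_mult cong_refl) (simp add: Cong.cong_def)
    ultimately show "[h * (u * x mod q) + n * modular_inverse q (u * x mod q) =
        h * u * x + n * modular_inverse q u * modular_inverse q x] (mod q)"
      unfolding mult.assoc by (intro cong_add)
  qed
  finally show ?thesis ..
qed

text \<open>
  For \<open>n > 0\<close> the number \<open>n x\<close> is determined by its residue \<open>k\<close> and
  by its quotient modulo \<open>q\<close>, and for \<open>0 \<le> x < q\<close> only \<open>n\<close>
  quotients occur.
\<close>

lemma card_linear_congruence_le:
  fixes n q k :: int
  assumes "q > 0" "n \<noteq> 0"
  shows "card {x \<in> {0..<q}. n * x mod q = k} \<le> nat \<bar>n\<bar>"
proof -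
  have pos: "card {x \<in> {0..<q}. m * x mod q = j} \<le> nat m" if "m > 0" for m j :: int
  proof -
    have "inj_on (\<lambda>x. m * x div q) {x \<in> {0..<q}. m * x mod q = j}"
    proof (rule inj_onI)
      fix x y assume "x \<in> {x \<in> {0..<q}. m * x mod q = j}" "y \<in> {x \<in> {0..<q}. m * x mod q = j}"
        "m * x div q = m * y div q"
      hence "m * x = m * y" by (metis (mono_tags, lifting) mem_Collect_eq mult_div_mod_eq)
      thus "x = y" using that by simp
    qed
    moreover have "(\<lambda>x. m * x div q) ` {x \<in> {0..<q}. m * x mod q = j} \<subseteq> {0..<m}"
    proof safe
      fix x assume x: "x \<in> {0..<q}"
      have "m * x < m * q" using x that by simp
      hence "m * x div q < m" using assms
        by (intro int_div_less_of_less_mult) (simp_all add: mult.commute)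
      moreover have "0 \<le> m * x div q" using x that assms by (simp add: pos_imp_zdiv_nonneg_iff)
      ultimately show "m * x div q \<in> {0..<m}" by simp
    qed
    ultimately have "card {x \<in> {0..<q}. m * x mod q = j} \<le> card {0..<m}"
      by (intro card_inj_on_le) auto
    thus ?thesis by simp
  qed
  show ?thesis
  proof (cases "n > 0")
    case True thus ?thesis using pos[of n k] by simp
  next
    case False
    have "{x \<in> {0..<q}. n * x mod q = k} \<subseteq> {x \<in> {0..<q}. (- n) * x mod q = (- k) mod q}"
      by (auto simp: mod_minus_eq)
    hence "card {x \<in> {0..<q}. n * x mod q = k} \<le> card {x \<in> {0..<q}. (- n) * x mod q = (- k) mod q}"
      by (intro card_mono) auto
    also have "\<dots> \<le> nat (- n)" using False assms by (intro pos) auto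
    finally show ?thesis using False assms by simp
  qed
qed

text \<open>
  The units \<open>u\<close> move the frequency \<open>(h, n)\<close> to \<open>(h u, n / u)\<close> without
  changing the sum. As \<open>n\<close> is not zero, the second coordinate alone takes each value for at
  most \<open>|n|\<close> units, so the orbit covers the complete fourth moment with bounded multiplicity.
  The bound is uniform in \<open>h\<close> and includes the Ramanujan sums (\<open>h = 0\<close>).
\<close>

lemma kloosterman_orbit:
  assumes "q > 0" "n \<noteq> 0"
  shows "real (card (units_mod q)) * norm (kloosterman q h n) ^ 4 \<le>
    \<bar>of_int n\<bar> * (\<Sum>h'\<in>{0..<q}. \<Sum>k\<in>{0..<q}. norm (kloosterman q h' k) ^ 4)"
proof -
  let ?I = "{0..<q}" and ?U = "units_mod q"
  let ?g = "\<lambda>k. \<Sum>h'\<in>?I. norm (kloosterman q h' k) ^ 4"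
  let ?b = "\<lambda>u. n * modular_inverse q u mod q"
  have fibre: "card {u \<in> ?U. ?b u = k} \<le> nat \<bar>n\<bar>" for k
  proof -
    have "card {u \<in> ?U. ?b u = k} \<le> card {x \<in> {0..<q}. n * x mod q = k}"
    proof (rule card_inj_on_le)
      show "inj_on (modular_inverse q) {u \<in> ?U. ?b u = k}"
        using inj_on_modular_inverse by (rule inj_on_subset) auto
      show "modular_inverse q ` {u \<in> ?U. ?b u = k} \<subseteq> {x \<in> {0..<q}. n * x mod q = k}"
        using assms by (auto simp: modular_inverse_int_nonneg modular_inverse_int_less)
    qed auto
    thus ?thesis using card_linear_congruence_le[OF assms, of k] by linarith
  qed
  have "real (card ?U) * norm (kloosterman q h n) ^ 4 =
      (\<Sum>u\<in>?U. norm (kloosterman q (h * u mod q) (?b u)) ^ 4)"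
    using assms by (simp add: kloosterman_mod kloosterman_scale units_modD)
  also have "\<dots> \<le> (\<Sum>u\<in>?U. ?g (?b u))"
    using assms by (intro sum_mono member_le_sum) auto
  also have "\<dots> = (\<Sum>k\<in>?I. \<Sum>u\<in>{u \<in> ?U. ?b u = k}. ?g (?b u))"
    by (rule sum.group[symmetric]) (use assms in auto)
  also have "\<dots> = (\<Sum>k\<in>?I. real (card {u \<in> ?U. ?b u = k}) * ?g k)"
    by (intro sum.cong refl) simp
  also have "\<dots> \<le> (\<Sum>k\<in>?I. \<bar>of_int n\<bar> * ?g k)"
  proof (intro sum_mono mult_right_mono sum_nonneg)
    fix k show "real (card {u \<in> ?U. ?b u = k}) \<le> \<bar>of_int n\<bar>"
      using fibre[of k] by linarith
  qed auto
  also have "\<dots> = \<bar>of_int n\<bar> * (\<Sum>h'\<in>?I. \<Sum>k\<in>?I. norm (kloosterman q h' k) ^ 4)"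
    unfolding sum_distrib_left[symmetric] by (subst sum.swap) simp
  finally show ?thesis .
qed

lemma card_residue_class_le:
  fixes d q r :: int
  assumes "q > 0" "d > 0" "d dvd q"
  shows "card {x \<in> {0..<q}. d dvd x - r} \<le> nat (q div d)"
proof -
  have "card {x \<in> {0..<q}. d dvd x - r} \<le> card {0..<q div d}"
  proof (rule card_inj_on_le[of "\<lambda>x. x div d"])
    show "inj_on (\<lambda>x. x div d) {x \<in> {0..<q}. d dvd x - r}"
    proof (rule inj_onI)
      fix x y assume "x \<in> {x \<in> {0..<q}. d dvd x - r}" "y \<in> {x \<in> {0..<q}. d dvd x - r}"
        and e: "x div d = y div d"
      hence "x mod d = r mod d" "y mod d = r mod d" by (auto simp: mod_eq_dvd_iff)
      thus "x = y" using e by (metis div_mult_mod_eq)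
    qed
    show "(\<lambda>x. x div d) ` {x \<in> {0..<q}. d dvd x - r} \<subseteq> {0..<q div d}"
    proof safe
      fix x assume x: "x \<in> {0..<q}"
      obtain m where m: "q = d * m" using assms by blast
      have "x div d < m" using x m assms by (intro int_div_less_of_less_mult) auto
      moreover have "0 \<le> x div d" using x assms by (simp add: pos_imp_zdiv_nonneg_iff)
      ultimately show "x div d \<in> {0..<q div d}" using m assms by simp
    qed
  qed auto
  thus ?thesis by simp
qed

text \<open>
  The product of the greatest common divisors of \<open>q\<close> with the three factors is a multiple of
  \<open>q\<close>, so the largest of them is at least the cube root of \<open>q\<close>.
\<close>

lemma dvd_mult3_imp_large_gcd:
  fixes q a b c :: int
  assumes "q > 0" "q dvd a * b * c"
  shows "\<exists>d\<in>divisors q. q \<le> d ^ 3 \<and> (d dvd a \<or> d dvd b \<or> d dvd c)"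
proof -
  let ?g = "\<lambda>x. gcd x q"
  have "q dvd ?g a * ?g b * ?g c"
  proof -
    obtain x y where xy: "q = x * y" "x dvd a * b" "y dvd c" using division_decomp[OF assms(2)] by blast
    then obtain z w where zw: "x = z * w" "z dvd a" "w dvd b" using division_decomp by blast
    have "z dvd ?g a" "w dvd ?g b" "y dvd ?g c" using xy zw by auto
    thus ?thesis using xy zw by (simp add: mult_dvd_mono)
  qed
  moreover have gpos: "?g x > 0" for x using assms(1) by simp
  ultimately have le: "q \<le> ?g a * ?g b * ?g c"
    by (intro zdvd_imp_le) auto
  define m where "m = max (?g a) (max (?g b) (?g c))"
  have m: "?g a \<le> m" "?g b \<le> m" "?g c \<le> m" by (auto simp: m_def)
  have "?g a * ?g b * ?g c \<le> m * m * m"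
    using m gpos by (intro mult_mono) (auto simp: less_imp_le intro: order.trans[OF less_imp_le[OF gpos]])
  hence "q \<le> m ^ 3" using le by (simp add: power3_eq_cube)
  moreover have "m = ?g a \<or> m = ?g b \<or> m = ?g c" by (auto simp: m_def max_def)
  moreover have "?g x \<in> divisors q" for x
  proof -
    have "1 \<le> ?g x" using gpos[of x] by linarith
    moreover have "?g x \<le> q" using assms(1) by (intro zdvd_imp_le) auto
    ultimately show ?thesis by (simp add: divisors_def)
  qed
  ultimately show ?thesis by (metis gcd_dvd1)
qed

lemma finite_divisors [simp]: "finite (divisors q)"
  unfolding divisors_def by (rule finite_subset[of _ "{1..q}"]) auto

lemma real_div_large_divisor_le:
  assumes "q > 0" "d \<in> divisors q" "q \<le> d ^ 3"
  shows "real (nat (q div d)) \<le> of_int q powr (2/3)"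
proof -
  have d: "d > 0" "d dvd q" using assms(2) by (auto simp: divisors_def)
  have "real_of_int q \<le> of_int d ^ 3" using assms(3) by (metis of_int_le_iff of_int_power)
  hence "real_of_int q powr (1/3) \<le> (of_int d ^ 3) powr (1/3)"
    using assms(1) by (intro powr_mono2) auto
  also have "\<dots> = real_of_int d" using d by (simp add: powr_powr flip: powr_numeral)
  finally have 1: "real_of_int q powr (1/3) \<le> of_int d" .
  have "real (nat (q div d)) = of_int q / of_int d"
    using assms(1) d by (simp add: real_of_int_div pos_imp_zdiv_nonneg_iff)
  also have "\<dots> \<le> of_int q / of_int q powr (1/3)"
    using 1 assms(1) by (intro divide_left_mono) (auto intro!: mult_pos_pos simp: d)
  also have "\<dots> = of_int q powr (1 - 1/3)"
    using assms(1) by (subst powr_diff) auto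
  finally show ?thesis by simp
qed

text \<open>
  Each of the three linear conditions modulo a divisor \<open>d\<close> of \<open>q\<close> with \<open>d^3
  \<ge> q\<close> leaves \<open>q (q / d) \<le> q^(5/3)\<close> pairs.
\<close>

lemma card_triple_product_le:
  fixes q z :: int
  assumes "q > 0"
  shows "real (card {(x, y). x \<in> {0..<q} \<and> y \<in> {0..<q} \<and> q dvd (x + y) * (x - z) * (y - z)})
    \<le> 3 * real (card (divisors q)) * of_int q powr (5/3)"
proof -
  let ?I = "{0..<q}"
  define D where "D = {d \<in> divisors q. q \<le> d ^ 3}"
  have finD: "finite D" by (simp add: D_def)
  define R where "R d r = {x \<in> ?I. d dvd x - r}" for d r
  have finR: "finite (R d r)" for d r by (simp add: R_def)
  define S where "S d = Sigma ?I (\<lambda>x. R d (- x)) \<union> (R d z \<times> ?I \<union> ?I \<times> R d z)" for d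
  have cardR: "real (card (R d r)) \<le> of_int q powr (2/3)" if "d \<in> D" for d r
  proof -
    have "card (R d r) \<le> nat (q div d)"
      unfolding R_def using that assms by (intro card_residue_class_le) (auto simp: D_def divisors_def)
    thus ?thesis using real_div_large_divisor_le[OF assms, of d] that by (simp add: D_def)
  qed
  have qq: "of_int q * of_int q powr (2/3) = real_of_int q powr (5/3)"
    using assms powr_add[of "real_of_int q" 1 "2/3"] by simp
  have cardS: "real (card (S d)) \<le> 3 * of_int q powr (5/3)" if "d \<in> D" for d
  proof -
    have "card (S d) \<le> card (Sigma ?I (\<lambda>x. R d (- x))) + (card (R d z \<times> ?I) + card (?I \<times> R d z))"
      unfolding S_def by (meson add_left_mono card_Un_le order.trans)
    also have "\<dots> = (\<Sum>x\<in>?I. card (R d (- x))) + (card (R d z) * nat q + nat q * card (R d z))"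
      using finR by (simp add: card_SigmaI card_cartesian_product)
    finally have "real (card (S d)) \<le> real (\<dots>)" by (rule of_nat_mono)
    also have "\<dots> = (\<Sum>x\<in>?I. real (card (R d (- x)))) + 2 * (real (nat q) * real (card (R d z)))" by simp
    also have "\<dots> \<le> (\<Sum>x\<in>?I. of_int q powr (2/3)) + 2 * (of_int q * of_int q powr (2/3))"
      using cardR[OF that] assms by (intro add_mono sum_mono mult_left_mono mult_mono) auto
    also have "\<dots> = 3 * of_int q powr (5/3)" using assms qq by simp
    finally show ?thesis .
  qed
  have "{(x, y). x \<in> ?I \<and> y \<in> ?I \<and> q dvd (x + y) * (x - z) * (y - z)} \<subseteq> (\<Union>d\<in>D. S d)"
  proof safe
    fix x y assume xy: "x \<in> ?I" "y \<in> ?I" "q dvd (x + y) * (x - z) * (y - z)"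
    obtain d where "d \<in> D" "d dvd x + y \<or> d dvd x - z \<or> d dvd y - z"
      using dvd_mult3_imp_large_gcd[OF assms xy(3)] by (auto simp: D_def)
    thus "(x, y) \<in> (\<Union>d\<in>D. S d)"
      using xy by (auto simp: S_def R_def add.commute intro!: bexI[of _ d])
  qed
  hence "card {(x, y). x \<in> ?I \<and> y \<in> ?I \<and> q dvd (x + y) * (x - z) * (y - z)} \<le> card (\<Union>d\<in>D. S d)"
    using finD finR by (intro card_mono) (auto simp: S_def)
  also have "\<dots> \<le> (\<Sum>d\<in>D. card (S d))" using finD by (rule card_UN_le)
  finally have "real (card {(x, y). x \<in> ?I \<and> y \<in> ?I \<and> q dvd (x + y) * (x - z) * (y - z)}) \<le> (\<Sum>d\<in>D. real (card (S d)))"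
    by (simp flip: of_nat_sum)
  also have "\<dots> \<le> (\<Sum>d\<in>D. 3 * of_int q powr (5/3))" by (intro sum_mono cardS)
  also have "\<dots> = real (card D) * (3 * of_int q powr (5/3))" by simp
  also have "\<dots> \<le> real (card (divisors q)) * (3 * of_int q powr (5/3))"
    by (intro mult_right_mono of_nat_mono card_mono) (auto simp: D_def)
  finally show ?thesis by (simp add: mult_ac)
qed

text \<open>
  Write \<open>s = x1 + x2\<close>. Clearing denominators in the second congruence gives \<open>s x3 x4 = s
  x1 x2\<close> modulo \<open>q\<close>, and \<open>x3 = s - x4\<close> turns \<open>x1 x2 - x3 x4\<close>
  into \<open>(x1 - x4) (x2 - x4)\<close>.
\<close>

lemma inverse_sum_identity:
  fixes q x1 x2 x3 x4 i1 i2 i3 i4 :: int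
  assumes inv: "[x1 * i1 = 1] (mod q)" "[x2 * i2 = 1] (mod q)" "[x3 * i3 = 1] (mod q)" "[x4 * i4 = 1] (mod q)"
    and s: "q dvd (x1 + x2) - (x3 + x4)" and i: "q dvd (i1 + i2) - (i3 + i4)"
  shows "q dvd (x1 + x2) * (x1 - x4) * (x2 - x4)"
proof -
  obtain a1 a2 a3 a4 where a: "x1 * i1 = 1 + q * a1" "x2 * i2 = 1 + q * a2" "x3 * i3 = 1 + q * a3" "x4 * i4 = 1 + q * a4"
    using inv by (metis cong_iff_lin cong_sym)
  obtain b c where b: "(x1 + x2) - (x3 + x4) = q * b" and c: "(i1 + i2) - (i3 + i4) = q * c" using s i by blast
  have A: "x1 * x2 * (i1 + i2) = (x1 + x2) + q * (a1 * x2 + a2 * x1)"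
  proof -
    have "x1 * x2 * (i1 + i2) = (x1 * i1) * x2 + (x2 * i2) * x1" by (simp add: algebra_simps)
    thus ?thesis unfolding a by (simp add: algebra_simps)
  qed
  have B: "x3 * x4 * (i3 + i4) = (x3 + x4) + q * (a3 * x4 + a4 * x3)"
  proof -
    have "x3 * x4 * (i3 + i4) = (x3 * i3) * x4 + (x4 * i4) * x3" by (simp add: algebra_simps)
    thus ?thesis unfolding a by (simp add: algebra_simps)
  qed
  define s where "s = x1 + x2"
  define P where "P = x1 * x2"
  define R where "R = x3 * x4"
  have "P * R * (i1 + i2) = R * (P * (i1 + i2))" by (simp only: mult_ac)
  also have "P * (i1 + i2) = s + q * (a1 * x2 + a2 * x1)" using A by (simp only: P_def s_def)
  finally have "P * R * (i1 + i2) = R * (s + q * (a1 * x2 + a2 * x1))" .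
  moreover have "P * R * (i3 + i4) = P * (s - q * b + q * (a3 * x4 + a4 * x3))"
  proof -
    have "R * (i3 + i4) = s - q * b + q * (a3 * x4 + a4 * x3)"
      using B b unfolding R_def s_def by linarith
    thus ?thesis by (simp only: mult.assoc)
  qed
  moreover have "P * R * (i1 + i2) - P * R * (i3 + i4) = P * R * (q * c)"
    by (simp only: right_diff_distrib[symmetric] c)
  ultimately have "R * (s + q * (a1 * x2 + a2 * x1)) - P * (s - q * b + q * (a3 * x4 + a4 * x3)) = P * R * (q * c)"
    by linarith
  hence 1: "s * (R - P) = q * (P * R * c - R * (a1 * x2 + a2 * x1) + P * (a3 * x4 + a4 * x3 - b))"
    by (simp add: algebra_simps)
  have "x3 = s - x4 - q * b" using b unfolding s_def by linarith
  hence R: "R = (s - x4 - q * b) * x4" unfolding R_def by simp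
  have "s * (x1 - x4) * (x2 - x4) = s * (P - R) - q * (s * b * x4)"
    by (simp add: R P_def s_def algebra_simps)
  also have "s * (P - R) = - (s * (R - P))" by (simp add: algebra_simps)
  also have "- (s * (R - P)) - q * (s * b * x4) = q * (- (P * R * c - R * (a1 * x2 + a2 * x1) + P * (a3 * x4 + a4 * x3 - b)) - s * b * x4)"
    unfolding 1 by (simp add: algebra_simps)
  finally show ?thesis by (simp add: s_def)
qed

text \<open>
  By orthogonality the moment counts quadruples of units; such a quadruple is determined by its last entry
  together with the first two, since \<open>x3 = x1 + x2 - x4\<close> modulo \<open>q\<close>.
\<close>

lemma kloosterman_fourth_moment:
  assumes "q > 0"
  shows "(\<Sum>h\<in>{0..<q}. \<Sum>k\<in>{0..<q}. norm (kloosterman q h k) ^ 4) \<le>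
    (of_int q)\<^sup>2 * (real (card (units_mod q)) * (3 * real (card (divisors q)) * of_int q powr (5/3)))"
proof -
  let ?U = "units_mod q" and ?v = "modular_inverse q"
  let ?W = "?U \<times> ?U"
  define \<phi> where "\<phi> = (\<lambda>(x::int, y). x + y)"
  define \<psi> where "\<psi> = (\<lambda>(x, y). ?v x + ?v y)"
  have "norm (kloosterman q h k) ^ 4 = (norm (\<Sum>w\<in>?W. chi q (h * \<phi> w + k * \<psi> w)))\<^sup>2" for h k
  proof -
    have "(kloosterman q h k)\<^sup>2 = (\<Sum>w\<in>?W. chi q (h * \<phi> w + k * \<psi> w))"
      unfolding kloosterman_def power2_eq_square sum_product sum.cartesian_product
      by (intro sum.cong refl) (auto simp: \<phi>_def \<psi>_def algebra_simps simp flip: chi_add)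
    hence "(norm (\<Sum>w\<in>?W. chi q (h * \<phi> w + k * \<psi> w)))\<^sup>2 = (norm ((kloosterman q h k)\<^sup>2))\<^sup>2" by simp
    thus ?thesis by (simp add: norm_power flip: power_mult)
  qed
  hence "(\<Sum>h\<in>{0..<q}. \<Sum>k\<in>{0..<q}. norm (kloosterman q h k) ^ 4) =
     (of_int q)\<^sup>2 * real (card {(w, w'). w \<in> ?W \<and> w' \<in> ?W \<and> q dvd \<phi> w - \<phi> w' \<and> q dvd \<psi> w - \<psi> w'})"
    using parseval_2d[OF assms, of ?W \<phi> \<psi>] by simp
  also have "\<dots> \<le> (of_int q)\<^sup>2 * (real (card ?U) * (3 * real (card (divisors q)) * of_int q powr (5/3)))"
  proof (rule mult_left_mono)
    let ?N = "{(w, w'). w \<in> ?W \<and> w' \<in> ?W \<and> q dvd \<phi> w - \<phi> w' \<and> q dvd \<psi> w - \<psi> w'}"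
    define P where "P z = {(x, y). x \<in> {0..<q} \<and> y \<in> {0..<q} \<and> q dvd (x + y) * (x - z) * (y - z)}" for z
    have finP: "finite (P z)" for z
      unfolding P_def by (rule finite_subset[of _ "{0..<q} \<times> {0..<q}"]) auto
    have "card ?N \<le> card (Sigma ?U P)"
    proof (rule card_inj_on_le[of "\<lambda>(w, w'). (snd w', w)"])
      show "inj_on (\<lambda>(w, w'). (snd w', w)) ?N"
      proof (rule inj_onI)
        fix p p' assume p: "p \<in> ?N" "p' \<in> ?N" "(case p of (w, w') \<Rightarrow> (snd w', w)) = (case p' of (w, w') \<Rightarrow> (snd w', w))"
        obtain x1 x2 x3 x4 where px: "p = ((x1, x2), (x3, x4))" by (metis surj_pair)
        obtain y3 where py: "p' = ((x1, x2), (y3, x4))" using p(3) px by (cases p') auto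
        have u: "x3 \<in> ?U" "y3 \<in> ?U"
          and "q dvd \<phi> (x1, x2) - \<phi> (x3, x4)" "q dvd \<phi> (x1, x2) - \<phi> (y3, x4)"
          using p(1,2) px py by auto
        hence "q dvd (x1 + x2 - (y3 + x4)) - (x1 + x2 - (x3 + x4))"
          unfolding \<phi>_def prod.case by (metis dvd_diff)
        hence "q dvd x3 - y3" by (simp add: algebra_simps)
        thus "p = p'" using u px py by (auto simp: units_mod_def mod_eq_dvd_iff[symmetric])
      qed
      show "(\<lambda>(w, w'). (snd w', w)) ` ?N \<subseteq> Sigma ?U P"
      proof (rule image_subsetI)
        fix p assume p: "p \<in> ?N"
        obtain x1 x2 x3 x4 where px: "p = ((x1, x2), (x3, x4))" by (metis surj_pair)
        have u: "x1 \<in> ?U" "x2 \<in> ?U" "x3 \<in> ?U" "x4 \<in> ?U"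
          and d: "q dvd \<phi> (x1, x2) - \<phi> (x3, x4)" "q dvd \<psi> (x1, x2) - \<psi> (x3, x4)"
          using p px by auto
        have "q dvd (x1 + x2) * (x1 - x4) * (x2 - x4)"
        proof (rule inverse_sum_identity)
          show "q dvd (x1 + x2) - (x3 + x4)" "q dvd (?v x1 + ?v x2) - (?v x3 + ?v x4)"
            using d by (simp_all add: \<phi>_def \<psi>_def)
        qed (use u in \<open>auto intro!: cong_modular_inverse1 simp: units_mod_def\<close>)
        thus "(case p of (w, w') \<Rightarrow> (snd w', w)) \<in> Sigma ?U P"
          using u px by (auto simp: P_def units_mod_def)
      qed
    qed (auto simp: finP)
    also have "\<dots> = (\<Sum>z\<in>?U. card (P z))" using finP by (simp add: card_SigmaI)
    finally have "real (card ?N) \<le> (\<Sum>z\<in>?U. real (card (P z)))" by (simp flip: of_nat_sum)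
    also have "\<dots> \<le> (\<Sum>z\<in>?U. 3 * real (card (divisors q)) * of_int q powr (5/3))"
      unfolding P_def by (intro sum_mono card_triple_product_le assms)
    finally show "real (card ?N) \<le> real (card ?U) * (3 * real (card (divisors q)) * of_int q powr (5/3))" by simp
  qed auto
  finally show ?thesis .
qed

text \<open>
  Divide the fourth moment bound by the number of units, which occurs on both sides. The fourth root of
  \<open>3 |n| d(q)\<close> is replaced by the number itself, which is affordable because
  \<open>d(q)\<close> is small on average.
\<close>

lemma kloosterman_bound:
  assumes "q > 0" "n \<noteq> 0"
  shows "norm (kloosterman q h n) \<le> 3 * \<bar>of_int n\<bar> * real (card (divisors q)) * of_int q powr (11/12)"
proof -
  define K u d where "K = norm (kloosterman q h n)" and "u = real (card (units_mod q))"
    and "d = real (card (divisors q))"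
  have u: "u > 0" using card_units_mod_pos[OF assms(1)] by (simp add: u_def)
  have "1 \<in> divisors q" using assms by (auto simp: divisors_def)
  hence "card (divisors q) \<ge> 1" by (metis One_nat_def Suc_leI card_gt_0_iff empty_iff finite_divisors)
  hence d: "d \<ge> 1" by (simp add: d_def)
  have n: "\<bar>real_of_int n\<bar> \<ge> 1" using assms by linarith
  have "u * K ^ 4 \<le> \<bar>of_int n\<bar> * ((of_int q)\<^sup>2 * (u * (3 * d * of_int q powr (5/3))))"
    using kloosterman_orbit[OF assms, of h] mult_left_mono[OF kloosterman_fourth_moment[OF assms(1)], of "\<bar>of_int n\<bar>"]
    unfolding u_def K_def d_def by linarith
  hence "u * K ^ 4 \<le> u * (3 * \<bar>of_int n\<bar> * d * ((of_int q)\<^sup>2 * of_int q powr (5/3)))"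
    by (simp add: mult_ac)
  hence "K ^ 4 \<le> 3 * \<bar>of_int n\<bar> * d * ((of_int q)\<^sup>2 * of_int q powr (5/3))" using u by simp
  also have "(of_int q)\<^sup>2 * of_int q powr (5/3) = (real_of_int q powr (11/12)) ^ 4"
  proof -
    have "(real_of_int q)\<^sup>2 = of_int q powr 2" using assms by (simp add: powr_numeral)
    hence "(of_int q)\<^sup>2 * of_int q powr (5/3) = real_of_int q powr (2 + 5/3)"
      by (simp only: powr_add)
    thus ?thesis using assms by (simp add: powr_power)
  qed
  also have "3 * \<bar>of_int n\<bar> * d * (real_of_int q powr (11/12)) ^ 4 \<le> (3 * \<bar>of_int n\<bar> * d) ^ 4 * (real_of_int q powr (11/12)) ^ 4"
  proof (intro mult_right_mono self_le_power)
    have "1 * 1 \<le> \<bar>real_of_int n\<bar> * d" using n d by (intro mult_mono) auto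
    thus "1 \<le> 3 * \<bar>real_of_int n\<bar> * d" by linarith
  qed auto
  also have "\<dots> = (3 * \<bar>of_int n\<bar> * d * of_int q powr (11/12)) ^ 4"
    by (simp only: power_mult_distrib)
  finally show ?thesis unfolding K_def d_def
    by (rule power_le_imp_le_base[of _ 3, simplified]) simp
qed

section \<open>Incomplete Kloosterman sums\<close>

text \<open>
  The summand of an incomplete Kloosterman sum, extended by zero to a function on all integers of period
  \<open>q\<close>, so that sums over intervals select the residues coprime to \<open>q\<close>
  automatically.
\<close>

definition inverse_char :: "int \<Rightarrow> int \<Rightarrow> int \<Rightarrow> complex" where
  "inverse_char q n b = (if coprime b q then chi q (n * modular_inverse q b) else 0)"

lemma norm_inverse_char_le: "norm (inverse_char q n b) \<le> 1"
  by (simp add: inverse_char_def)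

lemma modular_inverse_mod:
  fixes q b :: int
  assumes "coprime b q"
  shows "[modular_inverse q (b mod q) = modular_inverse q b] (mod q)"
proof (rule modular_inverse_cong_unique)
  have "[b mod q * modular_inverse q b = b * modular_inverse q b] (mod q)"
    by (intro cong_mult cong_refl) (simp add: Cong.cong_def)
  thus "[b mod q * modular_inverse q b = 1] (mod q)"
    using cong_modular_inverse1[OF assms] cong_trans by blast
qed

lemma inverse_char_mod: "inverse_char q n (b mod q) = inverse_char q n b"
proof (cases "coprime b q")
  case True
  moreover from True have "coprime (b mod q) q"
    by (metis coprime_iff_gcd_eq_1 gcd_mod_right gcd.commute gcd_red_int)
  ultimately show ?thesis
    unfolding inverse_char_def by (auto intro!: chi_cong cong_mult modular_inverse_mod)
next
  case False
  moreover from False have "\<not> coprime (b mod q) q"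
    by (metis coprime_iff_gcd_eq_1 gcd_mod_right gcd.commute gcd_red_int)
  ultimately show ?thesis by (simp add: inverse_char_def)
qed

lemma fourier_inverse_char: "(\<Sum>x\<in>{0..<q}. inverse_char q n x * chi q (h * x)) = kloosterman q h n"
proof -
  have "kloosterman q h n = (\<Sum>x\<in>{x \<in> {0..<q}. coprime x q}. chi q (h * x + n * modular_inverse q x))"
    by (simp add: kloosterman_def units_mod_def)
  also have "\<dots> = (\<Sum>x\<in>{0..<q}. if coprime x q then chi q (h * x + n * modular_inverse q x) else 0)"
    by (rule sum.inter_filter) simp
  also have "\<dots> = (\<Sum>x\<in>{0..<q}. inverse_char q n x * chi q (h * x))"
    by (intro sum.cong refl) (simp add: inverse_char_def chi_add mult.commute)
  finally show ?thesis ..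
qed

lemma card_residue_class_interval_le:
  fixes q l N r :: int
  assumes "q > 0" "N \<ge> 0"
  shows "real (card {s \<in> {l..<l + N}. s mod q = r}) \<le> of_int N / of_int q + 1"
proof -
  have "card {s \<in> {l..<l + N}. s mod q = r} \<le> card {0..N div q}"
  proof (rule card_inj_on_le[of "\<lambda>s. (s - l) div q"])
    show "inj_on (\<lambda>s. (s - l) div q) {s \<in> {l..<l + N}. s mod q = r}"
    proof (rule inj_onI)
      fix x y assume "x \<in> {s \<in> {l..<l + N}. s mod q = r}" "y \<in> {s \<in> {l..<l + N}. s mod q = r}"
        and e: "(x - l) div q = (y - l) div q"
      hence "(x - l) mod q = (y - l) mod q" by (metis (mono_tags, lifting) mem_Collect_eq mod_diff_left_eq)
      hence "x - l = y - l" using e by (metis div_mult_mod_eq)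
      thus "x = y" by simp
    qed
    show "(\<lambda>s. (s - l) div q) ` {s \<in> {l..<l + N}. s mod q = r} \<subseteq> {0..N div q}"
    proof safe
      fix s assume s: "s \<in> {l..<l + N}"
      have "(s - l) div q \<le> N div q" using s assms by (intro zdiv_mono1) auto
      thus "(s - l) div q \<in> {0..N div q}" using s assms by (simp add: pos_imp_zdiv_nonneg_iff)
    qed
  qed simp
  also have "\<dots> = nat (N div q + 1)" by simp
  finally have "real (card {s \<in> {l..<l + N}. s mod q = r}) \<le> real (nat (N div q + 1))" by (rule of_nat_mono)
  also have "\<dots> = of_int (N div q) + 1" using assms by (simp add: pos_imp_zdiv_nonneg_iff)
  also have "real_of_int (N div q) \<le> of_int N / of_int q"
    using real_of_int_div4 by blast
  finally show ?thesis by simp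
qed

lemma norm_sum_cnj: "norm (\<Sum>x\<in>A. c x * chi q (- (h * x))) = norm (\<Sum>x\<in>A. cnj (c x) * chi q (h * x))"
proof -
  have "(\<Sum>x\<in>A. cnj (c x) * chi q (h * x)) = cnj (\<Sum>x\<in>A. c x * chi q (- (h * x)))"
    by (simp add: cnj_chi)
  thus ?thesis by (simp only: complex_mod_cnj)
qed

text \<open>
  A periodic function all of whose finite Fourier coefficients are at most \<open>K\<close>.
\<close>

context
  fixes q :: int and f :: "int \<Rightarrow> complex" and K :: real
  assumes q: "q > 0"
    and periodic: "\<And>s. f (s mod q) = f s"
    and fourier: "\<And>h. norm (\<Sum>x\<in>{0..<q}. f x * chi q (h * x)) \<le> K"
    and bounded: "\<And>s. norm (f s) \<le> 1"
begin

lemma fourier_inversion: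
  "f s = (\<Sum>h\<in>{0..<q}. (\<Sum>x\<in>{0..<q}. f x * chi q (h * x)) / of_int q * chi q (- (s * h)))"
proof -
  have "(\<Sum>h\<in>{0..<q}. (\<Sum>x\<in>{0..<q}. f x * chi q (h * x)) / of_int q * chi q (- (s * h))) =
      (\<Sum>h\<in>{0..<q}. \<Sum>x\<in>{0..<q}. f x / of_int q * chi q (h * (x - s)))"
    unfolding sum_distrib_right sum_divide_distrib
  proof (intro sum.cong refl)
    fix h x
    have "chi q (h * (x - s)) = chi q (h * x) * chi q (- (s * h))"
      by (subst chi_add[symmetric]) (simp add: algebra_simps)
    thus "f x * chi q (h * x) / of_int q * chi q (- (s * h)) = f x / of_int q * chi q (h * (x - s))"
      by simp
  qed
  also have "\<dots> = (\<Sum>x\<in>{0..<q}. f x / of_int q * (\<Sum>h\<in>{0..<q}. chi q (h * (x - s))))"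
    by (subst sum.swap) (simp add: sum_distrib_left)
  also have "\<dots> = (\<Sum>x\<in>{0..<q}. if x = s mod q then f (s mod q) else 0)"
  proof (intro sum.cong refl)
    fix x assume "x \<in> {0..<q}"
    hence "q dvd x - s \<longleftrightarrow> x = s mod q" by (auto simp: mod_eq_dvd_iff[symmetric])
    thus "f x / of_int q * (\<Sum>h\<in>{0..<q}. chi q (h * (x - s))) = (if x = s mod q then f (s mod q) else 0)"
      using q by (simp add: chi_orthogonality)
  qed
  also have "\<dots> = f s" using q by (simp add: sum.delta periodic)
  finally show ?thesis ..
qed

text \<open>
  The windows of length \<open>H\<close> are a convolution of \<open>f\<close> with an indicator function,
  so their Fourier coefficients are products. Parseval's identity, used once for the windows and once for
  the indicator, gives the mean square.
\<close>

lemma sum_window_square_le: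
  assumes H: "0 \<le> H" "H \<le> q"
  shows "(\<Sum>s\<in>{0..<q}. (norm (\<Sum>t\<in>{0..<H}. f (s + t)))\<^sup>2) \<le> K\<^sup>2 * of_int H"
proof -
  let ?I = "{0..<q}"
  define F where "F h = (\<Sum>x\<in>?I. f x * chi q (h * x))" for h
  define w where "w h = (\<Sum>t\<in>{0..<H}. chi q (- (h * t)))" for h
  define c where "c h = F h / of_int q * w h" for h
  have K: "K \<ge> 0" using fourier[of 0] norm_ge_zero order.trans by blast
  have "(\<Sum>t\<in>{0..<H}. f (s + t)) = (\<Sum>h\<in>?I. c h * chi q (- (s * h)))" for s
  proof -
    have "(\<Sum>t\<in>{0..<H}. f (s + t)) = (\<Sum>t\<in>{0..<H}. \<Sum>h\<in>?I. F h / of_int q * chi q (- ((s + t) * h)))"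
      unfolding F_def by (subst fourier_inversion) simp
    also have "\<dots> = (\<Sum>h\<in>?I. \<Sum>t\<in>{0..<H}. F h / of_int q * chi q (- ((s + t) * h)))" by (rule sum.swap)
    also have "\<dots> = (\<Sum>h\<in>?I. c h * chi q (- (s * h)))"
    proof (rule sum.cong[OF refl])
      fix h
      have "chi q (- ((s + t) * h)) = chi q (- (h * t)) * chi q (- (s * h))" for t
        by (subst chi_add[symmetric]) (simp add: algebra_simps)
      thus "(\<Sum>t\<in>{0..<H}. F h / of_int q * chi q (- ((s + t) * h))) = c h * chi q (- (s * h))"
        by (simp add: c_def w_def sum_distrib_left sum_distrib_right mult_ac)
    qed
    finally show ?thesis .
  qed
  hence "(\<Sum>s\<in>?I. (norm (\<Sum>t\<in>{0..<H}. f (s + t)))\<^sup>2) = (\<Sum>s\<in>?I. (norm (\<Sum>h\<in>?I. cnj (c h) * chi q (s * h)))\<^sup>2)"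
    by (simp add: norm_sum_cnj)
  also have "\<dots> = of_int q * (\<Sum>h\<in>?I. (norm (c h))\<^sup>2)"
    by (subst parseval[OF q]) simp
  also have "\<dots> \<le> of_int q * (\<Sum>h\<in>?I. (K / of_int q)\<^sup>2 * (norm (w h))\<^sup>2)"
  proof (intro mult_left_mono sum_mono)
    fix h
    have "norm (c h) \<le> K / of_int q * norm (w h)"
      using fourier[of h] q by (simp add: c_def F_def norm_mult norm_divide divide_right_mono mult_right_mono)
    thus "(norm (c h))\<^sup>2 \<le> (K / of_int q)\<^sup>2 * (norm (w h))\<^sup>2"
      by (simp add: power_mono flip: power_mult_distrib)
  qed (use q in simp)
  also have "\<dots> = K\<^sup>2 / of_int q * (\<Sum>h\<in>?I. (norm (w h))\<^sup>2)"
    unfolding sum_distrib_left[symmetric] using q by (simp add: power2_eq_square)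
  also have "(\<Sum>h\<in>?I. (norm (w h))\<^sup>2) = of_int q * of_int H"
  proof -
    define e where "e t = (if t < H then 1 else 0 :: complex)" for t
    have "w h = (\<Sum>t\<in>?I. e t * chi q (- (h * t)))" for h
    proof -
      have "(\<Sum>t\<in>?I. e t * chi q (- (h * t))) = (\<Sum>t\<in>{t\<in>?I. t < H}. chi q (- (h * t)))"
        by (subst sum.inter_filter) (auto simp: e_def intro!: sum.cong)
      also have "{t\<in>?I. t < H} = {0..<H}" using H by auto
      finally show ?thesis by (simp add: w_def)
    qed
    hence "(\<Sum>h\<in>?I. (norm (w h))\<^sup>2) = (\<Sum>h\<in>?I. (norm (\<Sum>t\<in>?I. cnj (e t) * chi q (h * t)))\<^sup>2)"
      by (simp add: norm_sum_cnj)
    also have "\<dots> = of_int q * (\<Sum>t\<in>?I. (norm (e t))\<^sup>2)" by (subst parseval[OF q]) simp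
    also have "(\<Sum>t\<in>?I. (norm (e t))\<^sup>2) = (\<Sum>t\<in>?I. if t < H then 1 else 0)"
      by (intro sum.cong) (auto simp: e_def)
    also have "\<dots> = (\<Sum>t\<in>{t\<in>?I. t < H}. 1)" by (subst sum.inter_filter) auto
    also have "{t\<in>?I. t < H} = {0..<H}" using H by auto
    finally show ?thesis using H by simp
  qed
  finally show ?thesis using q by simp
qed

text \<open>
  Moving an interval by one position exchanges two terms.
\<close>

lemma norm_sum_shift_le:
  assumes "N \<ge> 0"
  shows "norm ((\<Sum>s\<in>{l..<l + N}. f (s + int t)) - (\<Sum>s\<in>{l..<l + N}. f s)) \<le> 2 * real t"
proof (induction t)
  case (Suc t)
  let ?J = "{l..<l + N}"
  have "(\<Sum>s\<in>?J. f (s + int (Suc t))) - (\<Sum>s\<in>?J. f (s + int t)) = f (l + N + int t) - f (l + int t)"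
  proof -
    have "(\<Sum>s\<in>?J. f (s + int (Suc t))) = (\<Sum>s\<in>{l + 1..<l + N + 1}. f (s + int t))"
      by (rule sum.reindex_bij_witness[of _ "\<lambda>s. s - 1" "\<lambda>s. s + 1"]) (auto simp: algebra_simps)
    moreover have "(\<Sum>s\<in>{l..<l + N + 1}. f (s + int t)) = f (l + int t) + (\<Sum>s\<in>{l + 1..<l + N + 1}. f (s + int t))"
    proof -
      have "{l..<l + N + 1} = insert l {l + 1..<l + N + 1}" using assms by auto
      thus ?thesis by simp
    qed
    moreover have "(\<Sum>s\<in>{l..<l + N + 1}. f (s + int t)) = f (l + N + int t) + (\<Sum>s\<in>?J. f (s + int t))"
    proof -
      have "{l..<l + N + 1} = insert (l + N) ?J" using assms by auto
      thus ?thesis by simp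
    qed
    ultimately show ?thesis by (simp add: algebra_simps)
  qed
  also have "norm (f (l + N + int t) - f (l + int t)) \<le> 2"
    using norm_triangle_ineq4[of "f (l + N + int t)" "f (l + int t)"] bounded[of "l + N + int t"] bounded[of "l + int t"]
    by linarith
  finally have "norm ((\<Sum>s\<in>?J. f (s + int (Suc t))) - (\<Sum>s\<in>?J. f (s + int t))) \<le> 2" .
  from norm_triangle_le[OF add_mono[OF this Suc]] show ?case by (simp add: algebra_simps)
qed simp

text \<open>
  The average of the sums over the translates by \<open>t < H\<close> differs from the sum itself by at most
  \<open>2 H\<close>. It is also \<open>1/H\<close> times the sum of the windows starting in the interval,
  to which Cauchy-Schwarz and the mean square of the windows apply; the interval meets each residue class at
  most \<open>N/q + 1\<close> times.
\<close>

lemma norm_incomplete_sum_le: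
  assumes H: "1 \<le> H" "H \<le> q" and N: "N \<ge> 0"
  shows "norm (\<Sum>s\<in>{l..<l + N}. f s) \<le> 2 * of_int H + K * sqrt (of_int N * (of_int N / of_int q + 1) / of_int H)"
proof -
  let ?J = "{l..<l + N}" and ?T = "{0..<H}"
  \<comment> \<open>The window of length \<open>H\<close> that starts at \<open>s\<close>.\<close>
  define F where "F s = (\<Sum>t\<in>?T. f (s + t))" for s
  have K: "K \<ge> 0" using fourier[of 0] norm_ge_zero order.trans by blast
  have Fmod: "F (s mod q) = F s" for s
  proof -
    have "f (s mod q + t) = f (s + t)" for t
      using periodic[of "s mod q + t"] periodic[of "s + t"] by (simp add: mod_simps)
    thus ?thesis by (simp add: F_def)
  qed
  have "(\<Sum>s\<in>?J. (norm (F s))\<^sup>2) = (\<Sum>r\<in>{0..<q}. \<Sum>s\<in>{s\<in>?J. s mod q = r}. (norm (F s))\<^sup>2)"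
    by (rule sum.group[symmetric]) (use q in auto)
  also have "\<dots> = (\<Sum>r\<in>{0..<q}. real (card {s\<in>?J. s mod q = r}) * (norm (F r))\<^sup>2)"
  proof (rule sum.cong[OF refl])
    fix r
    have "(\<Sum>s\<in>{s\<in>?J. s mod q = r}. (norm (F s))\<^sup>2) = (\<Sum>s\<in>{s\<in>?J. s mod q = r}. (norm (F r))\<^sup>2)"
      by (rule sum.cong[OF refl]) (use Fmod in auto)
    thus "(\<Sum>s\<in>{s\<in>?J. s mod q = r}. (norm (F s))\<^sup>2) = real (card {s\<in>?J. s mod q = r}) * (norm (F r))\<^sup>2"
      by simp
  qed
  also have "\<dots> \<le> (\<Sum>r\<in>{0..<q}. (of_int N / of_int q + 1) * (norm (F r))\<^sup>2)"
    by (intro sum_mono mult_right_mono card_residue_class_interval_le q N) auto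
  also have "\<dots> \<le> (of_int N / of_int q + 1) * (K\<^sup>2 * of_int H)"
    unfolding sum_distrib_left[symmetric] F_def using H q N by (intro mult_left_mono sum_window_square_le) auto
  finally have sq: "(\<Sum>s\<in>?J. (norm (F s))\<^sup>2) \<le> (of_int N / of_int q + 1) * (K\<^sup>2 * of_int H)" .
  have "(\<Sum>s\<in>?J. norm (F s))\<^sup>2 \<le> real (card ?J) * (\<Sum>s\<in>?J. (norm (F s))\<^sup>2)"
    using Cauchy_Schwarz_ineq_sum[of "\<lambda>_. 1" "\<lambda>s. norm (F s)" ?J] by simp
  also have "\<dots> \<le> real (card ?J) * ((of_int N / of_int q + 1) * (K\<^sup>2 * of_int H))"
    by (intro mult_left_mono sq) auto
  also have "\<dots> = (K * of_int H)\<^sup>2 * (of_int N * (of_int N / of_int q + 1) / of_int H)"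
    using N H by (simp add: power2_eq_square field_simps)
  finally have "(\<Sum>s\<in>?J. norm (F s)) \<le> sqrt ((K * of_int H)\<^sup>2 * (of_int N * (of_int N / of_int q + 1) / of_int H))"
    by (intro real_le_rsqrt)
  also have "\<dots> = of_int H * (K * sqrt (of_int N * (of_int N / of_int q + 1) / of_int H))"
    by (subst real_sqrt_mult) (use K H in simp)
  finally have F1: "(\<Sum>s\<in>?J. norm (F s)) \<le> of_int H * (K * sqrt (of_int N * (of_int N / of_int q + 1) / of_int H))" .
  define S where "S = (\<Sum>s\<in>?J. f s)"
  have "of_int H * S - (\<Sum>s\<in>?J. F s) = (\<Sum>t\<in>?T. S - (\<Sum>s\<in>?J. f (s + t)))"
    unfolding F_def by (subst sum.swap) (use H in \<open>simp add: sum_subtractf\<close>)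
  also have "norm \<dots> \<le> (\<Sum>t\<in>?T. 2 * of_int H)"
  proof (rule sum_norm_le)
    fix t assume t: "t \<in> ?T"
    have "norm (S - (\<Sum>s\<in>?J. f (s + t))) \<le> 2 * real (nat t)"
      using norm_sum_shift_le[OF N, where l = l and t = "nat t"] t by (simp add: S_def norm_minus_commute)
    also have "\<dots> \<le> 2 * of_int H" using t by simp
    finally show "norm (S - (\<Sum>s\<in>?J. f (s + t))) \<le> 2 * of_int H" .
  qed
  also have "\<dots> = of_int H * (2 * of_int H)" using H by simp
  finally have F2: "norm (of_int H * S - (\<Sum>s\<in>?J. F s)) \<le> of_int H * (2 * of_int H)" .
  have "of_int H * norm S = norm (of_int H * S)" using H by (simp add: norm_mult)
  also have "\<dots> \<le> norm (of_int H * S - (\<Sum>s\<in>?J. F s)) + norm (\<Sum>s\<in>?J. F s)"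
    using norm_triangle_sub by (metis add.commute)
  also have "\<dots> \<le> of_int H * (2 * of_int H) + of_int H * (K * sqrt (of_int N * (of_int N / of_int q + 1) / of_int H))"
    using F1 F2 norm_sum[of F ?J] by linarith
  also have "\<dots> = of_int H * (2 * of_int H + K * sqrt (of_int N * (of_int N / of_int q + 1) / of_int H))"
    by (simp only: distrib_left)
  finally show ?thesis using H unfolding S_def by simp
qed

end

text \<open>
  Count the pairs of a number up to \<open>N\<close> and a divisor of it, beginning with the divisor.
\<close>

lemma sum_card_divisors_le:
  assumes "N > 0"
  shows "(\<Sum>q\<in>{1..int N}. real (card (divisors q))) \<le> real N * (1 + ln (real N))"
proof -
  let ?A = "{1..int N}"
  have "(\<Sum>q\<in>?A. real (card (divisors q))) = (\<Sum>q\<in>?A. \<Sum>d\<in>?A. if d dvd q then 1 else 0)"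
  proof (rule sum.cong[OF refl])
    fix q assume q: "q \<in> ?A"
    have "divisors q = {d \<in> ?A. d dvd q}"
      using q by (auto simp: divisors_def dest: zdvd_imp_le)
    thus "real (card (divisors q)) = (\<Sum>d\<in>?A. if d dvd q then 1 else 0)"
      by (simp add: sum.inter_filter[symmetric])
  qed
  also have "\<dots> = (\<Sum>d\<in>?A. \<Sum>q\<in>?A. if d dvd q then 1 else 0)" by (rule sum.swap)
  also have "\<dots> \<le> (\<Sum>d\<in>?A. real N / of_int d)"
  proof (rule sum_mono)
    fix d assume d: "d \<in> ?A"
    have "card {q \<in> ?A. d dvd q} \<le> card {1..int N div d}"
    proof (rule card_inj_on_le[of "\<lambda>q. q div d"])
      show "inj_on (\<lambda>q. q div d) {q \<in> ?A. d dvd q}"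
        by (rule inj_onI) (metis (mono_tags, lifting) dvd_div_mult_self mem_Collect_eq)
      show "(\<lambda>q. q div d) ` {q \<in> ?A. d dvd q} \<subseteq> {1..int N div d}"
      proof safe
        fix q assume q: "q \<in> ?A" "d dvd q"
        hence "d \<le> q" by (auto dest: zdvd_imp_le)
        hence "0 < q div d" using d by (simp add: pos_imp_zdiv_pos_iff)
        moreover have "q div d \<le> int N div d" using q d by (intro zdiv_mono1) auto
        ultimately show "q div d \<in> {1..int N div d}" by simp
      qed
    qed simp
    hence "real (card {q \<in> ?A. d dvd q}) \<le> real (nat (int N div d))" by simp
    also have "\<dots> = of_int (int N div d)" using d by (simp add: pos_imp_zdiv_nonneg_iff)
    also have "\<dots> \<le> real N / of_int d" using real_of_int_div4[of "int N" d] by simp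
    finally show "(\<Sum>q\<in>?A. if d dvd q then 1 else 0) \<le> real N / of_int d"
      by (simp add: sum.inter_filter[symmetric])
  qed
  also have "\<dots> = (\<Sum>d\<in>{1..N}. real N / real d)"
    by (rule sum.reindex_bij_witness[of _ int nat]) auto
  also have "\<dots> = real N * harm N"
    by (simp add: harm_def sum_distrib_left divide_inverse)
  also have "harm N \<le> 1 + ln (real N)"
  proof -
    obtain m where m: "N = Suc m" using assms gr0_conv_Suc by blast
    have "harm (Suc m) - ln (real (Suc m)) \<le> harm (Suc 0) - ln (real (Suc 0))"
      using decseqD[OF decseq_harm_diff_ln, of 0 m] by simp
    thus ?thesis by (simp add: m harm_Suc harm_expand)
  qed
  finally show ?thesis by (simp add: mult_left_mono)
qed


text \<open>
  For moduli below the window length \<open>H\<close> the trivial bound is used. Otherwise \<open>q \<le>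
  M\<close> allows \<open>N/q + 1\<close> to be replaced by \<open>2 M/q\<close>, and the factor
  \<open>q^(11/12)\<close> of the complete sums is reduced to \<open>q^(5/12)\<close>.
\<close>

lemma norm_inverse_char_sum_le:
  assumes q: "1 \<le> q" "q \<le> int M" and n: "n \<noteq> 0" and N: "0 \<le> N" "N \<le> int M" and H: "1 \<le> H"
  shows "norm (\<Sum>b\<in>{l..<l + N}. inverse_char q n b) \<le>
    (if q < H then real M else 2 * of_int H) +
    5 * \<bar>of_int n\<bar> * real (card (divisors q)) * (real M powr (17/12) / sqrt (of_int H))"
proof (cases "q < H")
  case True
  have "norm (\<Sum>b\<in>{l..<l + N}. inverse_char q n b) \<le> (\<Sum>b\<in>{l..<l + N}. 1)"
    by (intro sum_norm_le norm_inverse_char_le)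
  also have "\<dots> \<le> real M" using N by simp
  finally show ?thesis using True H by (simp add: add_increasing2)
next
  case False
  define K where "K = 3 * \<bar>real_of_int n\<bar> * real (card (divisors q)) * of_int q powr (11/12)"
  have M: "M > 0" using q by simp
  have "norm (\<Sum>b\<in>{l..<l + N}. inverse_char q n b) \<le> 2 * of_int H + K * sqrt (of_int N * (of_int N / of_int q + 1) / of_int H)"
  proof (rule norm_incomplete_sum_le)
    show "norm (\<Sum>x\<in>{0..<q}. inverse_char q n x * chi q (h * x)) \<le> K" for h
      unfolding fourier_inverse_char K_def using q n by (intro kloosterman_bound) auto
  qed (use q H N False in \<open>auto simp: inverse_char_mod norm_inverse_char_le\<close>)
  also have "K * sqrt (of_int N * (of_int N / of_int q + 1) / of_int H) \<le>
      K * sqrt (real M * (2 * real M / of_int q) / of_int H)"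
  proof (intro mult_left_mono real_sqrt_le_mono divide_right_mono mult_mono)
    have "1 \<le> real M / of_int q" using q by simp
    moreover have "real_of_int N / of_int q \<le> real M / of_int q" using N q by (intro divide_right_mono) auto
    ultimately show "real_of_int N / of_int q + 1 \<le> 2 * real M / of_int q" by simp
  qed (use q N H in \<open>auto simp: K_def\<close>)
  also have "sqrt (real M * (2 * real M / of_int q) / of_int H) = sqrt 2 * real M / (sqrt (of_int q) * sqrt (of_int H))"
  proof -
    have "real M * (2 * real M / of_int q) / of_int H = 2 * (real M)\<^sup>2 / (of_int q * of_int H)"
      by (simp add: power2_eq_square)
    thus ?thesis by (simp add: real_sqrt_divide real_sqrt_mult)
  qed
  also have "K * \<dots> = 3 * sqrt 2 * \<bar>real_of_int n\<bar> * real (card (divisors q)) *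
      (real M * (of_int q powr (11/12) / sqrt (of_int q)) / sqrt (of_int H))"
    by (simp add: K_def mult_ac)
  also have "of_int q powr (11/12) / sqrt (of_int q) = real_of_int q powr (5/12)"
    using q by (simp add: powr_half_sqrt[symmetric] powr_diff[symmetric])
  also have "3 * sqrt 2 * \<bar>real_of_int n\<bar> * real (card (divisors q)) *
      (real M * real_of_int q powr (5/12) / sqrt (of_int H)) \<le>
      5 * \<bar>real_of_int n\<bar> * real (card (divisors q)) *
      (real M * real M powr (5/12) / sqrt (of_int H))"
  proof (intro mult_mono divide_right_mono powr_mono2)
    have "sqrt 2 \<le> (5/3 :: real)" by (rule real_le_lsqrt) (simp_all add: power2_eq_square)
    thus "3 * sqrt 2 \<le> (5::real)" by simp
  qed (use q H in auto)
  also have "real M * real M powr (5/12) = real M powr (17/12)"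
    using M powr_add[of "real M" 1 "5/12"] by simp
  finally show ?thesis using False by simp
qed

text \<open>
  The two error terms are \<open>H M\<close> and, up to a logarithm, \<open>M^(29/12)\<close> divided by the
  square root of \<open>H\<close>. They are both \<open>o(M^2)\<close> when \<open>H\<close> is a power of
  \<open>M\<close> with exponent strictly between \<open>5/6\<close> and \<open>1\<close>; the exponent is
  \<open>11/12\<close>.
\<close>

lemma inverse_char_sums_average:
  assumes n: "n \<noteq> 0"
  obtains E :: "nat \<Rightarrow> real" where "(\<lambda>M. E M / (real M)\<^sup>2) \<longlonglongrightarrow> 0"
    and "\<And>M l N. (\<And>q. 0 \<le> N q \<and> N q \<le> int M) \<Longrightarrow> M > 0 \<Longrightarrow>
      (\<Sum>q\<in>{1..int M}. norm (\<Sum>b\<in>{l q..<l q + N q}. inverse_char q n b)) \<le> E M"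
proof
  define E where "E M = 6 * real M powr (23/12) + 5 * \<bar>real_of_int n\<bar> * (real M powr (47/24) * (1 + ln (real M)))" for M
  have "((\<lambda>x::real. (6 * x powr (23/12) + c * (x powr (47/24) * (1 + ln x))) / x\<^sup>2) \<longlongrightarrow> 0) at_top" for c
    by real_asymp
  from filterlim_compose[OF this filterlim_real_sequentially]
  show "(\<lambda>M. E M / (real M)\<^sup>2) \<longlonglongrightarrow> 0" unfolding E_def .
next
  fix M :: nat and l N :: "int \<Rightarrow> int"
  assume N: "\<And>q. 0 \<le> N q \<and> N q \<le> int M" and M: "M > 0"
  define E where "E M = 6 * real M powr (23/12) + 5 * \<bar>real_of_int n\<bar> * (real M powr (47/24) * (1 + ln (real M)))" for M
  define H where "H = \<lceil>real M powr (11/12)\<rceil>"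
  have M1: "real M powr (11/12) \<ge> 1" using M by (simp add: ge_one_powr_ge_zero)
  have H: "1 \<le> H" "real M powr (11/12) \<le> of_int H" "of_int H \<le> 2 * real M powr (11/12)"
    using M1 unfolding H_def by linarith+
  let ?A = "{1..int M}"
  have "(\<Sum>q\<in>?A. norm (\<Sum>b\<in>{l q..<l q + N q}. inverse_char q n b)) \<le>
     (\<Sum>q\<in>?A. (if q < H then real M else 2 * of_int H) +
      5 * \<bar>of_int n\<bar> * real (card (divisors q)) * (real M powr (17/12) / sqrt (of_int H)))"
    using N H n by (intro sum_mono norm_inverse_char_sum_le) auto
  also have "\<dots> = (\<Sum>q\<in>?A. (if q < H then real M else 2 * of_int H)) +
      5 * \<bar>of_int n\<bar> * (\<Sum>q\<in>?A. real (card (divisors q))) * (real M powr (17/12) / sqrt (of_int H))"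
    by (simp only: sum.distrib sum_distrib_left sum_distrib_right)
  also have "(\<Sum>q\<in>?A. (if q < H then real M else 2 * of_int H)) \<le> 3 * of_int H * real M"
  proof -
    have "(\<Sum>q\<in>?A. (if q < H then real M else 2 * of_int H)) \<le> (\<Sum>q\<in>?A. (if q < H then real M else 0) + 2 * of_int H)"
      using H by (intro sum_mono) auto
    also have "\<dots> = real (card {q\<in>?A. q < H}) * real M + real M * (2 * of_int H)"
      by (simp add: sum.distrib sum.inter_filter[symmetric])
    also have "card {q\<in>?A. q < H} \<le> card {1..<H}" by (intro card_mono) auto
    hence "real (card {q\<in>?A. q < H}) * real M \<le> of_int H * real M"
      using H by (intro mult_right_mono) auto
    finally show ?thesis by (simp add: mult_ac)
  qed
  also have "3 * of_int H * real M \<le> 6 * real M powr (23/12)"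
  proof -
    have "3 * of_int H * real M \<le> 3 * (2 * real M powr (11/12)) * real M"
      using H by (intro mult_mono) auto
    also have "\<dots> = 6 * (real M powr (11/12) * real M powr 1)" by simp
    also have "\<dots> = 6 * real M powr (23/12)" by (simp only: powr_add[symmetric]) simp
    finally show ?thesis .
  qed
  also have "5 * \<bar>of_int n\<bar> * (\<Sum>q\<in>?A. real (card (divisors q))) * (real M powr (17/12) / sqrt (of_int H)) \<le>
     5 * \<bar>of_int n\<bar> * (real M * (1 + ln (real M))) * (real M powr (17/12) / real M powr (11/24))"
  proof (intro mult_mono divide_left_mono sum_card_divisors_le M)
    have "real M powr (11/24) = sqrt (real M powr (11/12))"
      using M by (simp add: powr_half_sqrt[symmetric] powr_powr)
    thus "real M powr (11/24) \<le> sqrt (of_int H)" using H by simp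
  qed (use M H in \<open>auto simp: sum_nonneg\<close>)
  also have "\<dots> = 5 * \<bar>of_int n\<bar> * ((real M powr 1 * (real M powr (17/12) / real M powr (11/24))) * (1 + ln (real M)))"
    by simp
  also have "real M powr 1 * (real M powr (17/12) / real M powr (11/24)) = real M powr (47/24)"
    by (simp only: powr_diff[symmetric] powr_add[symmetric]) simp
  finally show "(\<Sum>q\<in>?A. norm (\<Sum>b\<in>{l q..<l q + N q}. inverse_char q n b)) \<le>
     6 * real M powr (23/12) + 5 * \<bar>real_of_int n\<bar> * (real M powr (47/24) * (1 + ln (real M)))"
    by simp
qed

section \<open>Weyl's criterion\<close>

definition in_arc :: "real \<Rightarrow> real \<Rightarrow> real \<Rightarrow> bool" where
  "in_arc a b x \<longleftrightarrow> (\<exists>k::int. a \<le> x + of_int k \<and> x + of_int k \<le> b)"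

lemma compact_circ_image: "compact (circ ` {a..b})"
  unfolding circ_def by (intro compact_continuous_image continuous_intros) auto

lemma sum_roots_of_unity_power:
  assumes "0 < k" "k < m"
  shows "(\<Sum>j<m. circ (real j / real m) ^ k) = 0"
proof -
  define z where "z = circ (real k / real m)"
  have "(\<Sum>j<m. circ (real j / real m) ^ k) = (\<Sum>j<m. z ^ j)"
    by (simp add: z_def circ_power mult.commute)
  moreover have "z \<noteq> 1"
  proof
    assume "z = 1"
    hence "circ (real k / real m) = circ 0" by (simp add: z_def circ_def)
    then obtain n :: int where "real k / real m = of_int n" by (auto simp: circ_eq_iff)
    hence "real k = real m * of_int n" using assms by (simp add: field_simps)
    hence "int k = int m * n" by (metis of_int_eq_iff of_int_mult of_int_of_nat_eq)
    hence "m dvd k" by (metis dvd_triv_left int_dvd_int_iff)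
    thus False using assms by (auto dest: dvd_imp_le)
  qed
  moreover have "z ^ m = 1"
    using assms by (simp add: z_def circ_power) (simp add: circ_def)
  ultimately show ?thesis by (simp add: geometric_sum)
qed

text \<open>
  A grid point \<open>j/m\<close> with \<open>j/m + k\<close> in the interval corresponds to the integer
  \<open>j + m k\<close> in the interval dilated by \<open>m\<close>.
\<close>

lemma card_in_arc_equidistant_le:
  assumes "a \<le> b" "m > 0"
  shows "real (card {j. j < m \<and> in_arc a b (real j / real m)}) \<le> real m * (b - a) + 1"
proof -
  let ?S = "{j. j < m \<and> in_arc a b (real j / real m)}"
  have "\<exists>k::int. a \<le> real j / real m + of_int k \<and> real j / real m + of_int k \<le> b" if "j \<in> ?S" for j
    using that by (auto simp: in_arc_def)
  then obtain k :: "nat \<Rightarrow> int" where k: "\<And>j. j \<in> ?S \<Longrightarrow> a \<le> real j / real m + of_int (k j) \<and> real j / real m + of_int (k j) \<le> b"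
    by metis
  have "card ?S \<le> card {\<lceil>real m * a\<rceil>..\<lfloor>real m * b\<rfloor>}"
  proof (rule card_inj_on_le[of "\<lambda>j. int j + int m * k j"])
    show "inj_on (\<lambda>j. int j + int m * k j) ?S"
    proof (rule inj_onI)
      fix i j assume ij: "i \<in> ?S" "j \<in> ?S" "int i + int m * k i = int j + int m * k j"
      hence "(int i + int m * k i) mod int m = (int j + int m * k j) mod int m" by simp
      hence "int i mod int m = int j mod int m" by simp
      thus "i = j" using ij(1,2) by simp
    qed
    show "(\<lambda>j. int j + int m * k j) ` ?S \<subseteq> {\<lceil>real m * a\<rceil>..\<lfloor>real m * b\<rfloor>}"
    proof (rule image_subsetI)
      fix j assume "j \<in> ?S"
      from k[OF this] assms have "real m * a \<le> real m * (real j / real m + of_int (k j))"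
        "real m * (real j / real m + of_int (k j)) \<le> real m * b" by (auto intro!: mult_left_mono)
      moreover have "real m * (real j / real m + of_int (k j)) = of_int (int j + int m * k j)"
        using assms by (simp add: distrib_left)
      ultimately show "int j + int m * k j \<in> {\<lceil>real m * a\<rceil>..\<lfloor>real m * b\<rfloor>}"
        unfolding atLeastAtMost_iff ceiling_le_iff le_floor_iff by (metis)
    qed
  qed simp
  also have "\<dots> = nat (\<lfloor>real m * b\<rfloor> - \<lceil>real m * a\<rceil> + 1)" by simp
  finally have "real (card ?S) \<le> real (nat (\<lfloor>real m * b\<rfloor> - \<lceil>real m * a\<rceil> + 1))" by (rule of_nat_mono)
  also have "\<dots> = max 0 (of_int (\<lfloor>real m * b\<rfloor> - \<lceil>real m * a\<rceil> + 1))" by linarith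
  also have "\<dots> \<le> real m * (b - a) + 1"
  proof (rule max.boundedI)
    show "0 \<le> real m * (b - a) + 1" using assms by simp
    show "real_of_int (\<lfloor>real m * b\<rfloor> - \<lceil>real m * a\<rceil> + 1) \<le> real m * (b - a) + 1"
      by (simp add: right_diff_distrib) linarith
  qed
  finally show ?thesis .
qed

lemma norm_average_le:
  fixes h :: "'b \<Rightarrow> complex"
  assumes "\<And>x. norm (h x) \<le> e"
  shows "norm ((\<Sum>x\<in>B. h x) / of_nat (card B)) \<le> e"
proof (cases "card B = 0")
  case True
  have "0 \<le> e" using assms norm_ge_zero order.trans by blast
  thus ?thesis using True by simp
next
  case False
  have "norm (\<Sum>x\<in>B. h x) \<le> (\<Sum>x\<in>B. e)" by (intro sum_norm_le assms)
  hence "norm (\<Sum>x\<in>B. h x) \<le> e * real (card B)" by (simp add: mult.commute)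
  thus ?thesis using False unfolding norm_divide norm_of_nat by (subst pos_divide_le_eq) auto
qed

text \<open>
  Finite families of points indexed by a parameter tending to infinity, whose exponential sums are of
  smaller order than their size.
\<close>

locale weyl_family =
  fixes A :: "real \<Rightarrow> 'a set" and f :: "'a \<Rightarrow> real"
  assumes finite_A: "\<And>T. finite (A T)"
    and card_A: "filterlim (\<lambda>T. real (card (A T))) at_top at_top"
    and weyl: "\<And>k. k > 0 \<Longrightarrow> ((\<lambda>T. (\<Sum>v\<in>A T. circ (f v) ^ k) / of_nat (card (A T))) \<longlongrightarrow> 0) at_top"
begin

definition grid :: "real \<Rightarrow> nat" where "grid T = nat \<lceil>T\<rceil>"

text \<open>
  The difference of the averages of a test function over the given points and over the vertices of a regular
  polygon whose number of vertices grows with \<open>T\<close>. Since the vertices are visibly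
  equidistributed, they take the place of the integral over the circle.
\<close>

definition deviation :: "(complex \<Rightarrow> complex) \<Rightarrow> real \<Rightarrow> complex" where
  "deviation g T = (\<Sum>v\<in>A T. g (circ (f v))) / of_nat (card (A T)) -
     (\<Sum>j<grid T. g (circ (real j / real (grid T)))) / of_nat (grid T)"

lemma grid_at_top: "filterlim grid at_top at_top"
  unfolding filterlim_at_top
proof
  fix Z
  show "\<forall>\<^sub>F T in at_top. Z \<le> grid T"
    using eventually_ge_at_top[of "real Z"]
    by eventually_elim (simp add: grid_def, linarith)
qed

lemma eventually_grid_gt: "eventually (\<lambda>T. grid T > n) at_top"
  using grid_at_top unfolding filterlim_at_top Suc_le_eq[symmetric] by blast

lemma eventually_card_pos: "eventually (\<lambda>T. card (A T) > 0) at_top"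
proof -
  have "eventually (\<lambda>T. real (card (A T)) > 0) at_top"
    using card_A unfolding filterlim_at_top_dense by blast
  thus ?thesis by eventually_elim simp
qed

lemma deviation_add: "deviation (\<lambda>z. g z + h z) T = deviation g T + deviation h T"
  by (simp add: deviation_def sum.distrib add_divide_distrib)

lemma deviation_cmult: "deviation (\<lambda>z. c * g z) T = c * deviation g T"
  by (simp add: deviation_def sum_distrib_left[symmetric] right_diff_distrib)

lemma deviation_add_tendsto: "(deviation g \<longlongrightarrow> 0) at_top \<Longrightarrow> (deviation h \<longlongrightarrow> 0) at_top \<Longrightarrow> (deviation (\<lambda>z. g z + h z) \<longlongrightarrow> 0) at_top"
  unfolding deviation_add using tendsto_add[of "deviation g" 0 _ "deviation h" 0] by simp

lemma deviation_cmult_tendsto: "(deviation g \<longlongrightarrow> 0) at_top \<Longrightarrow> (deviation (\<lambda>z. c * g z) \<longlongrightarrow> 0) at_top"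
  unfolding deviation_cmult by (rule tendsto_mult_right_zero)

lemma deviation_cong: "(\<And>z. norm z = 1 \<Longrightarrow> g z = h z) \<Longrightarrow> deviation g = deviation h"
  by (auto simp: deviation_def fun_eq_iff)

text \<open>
  Once the polygon has more than \<open>k\<close> vertices, its own exponential sum vanishes.
\<close>

lemma deviation_power_tendsto:
  assumes "k > 0"
  shows "(deviation (\<lambda>z. z ^ k) \<longlongrightarrow> 0) at_top"
proof (rule Lim_transform_eventually[OF weyl[OF assms]])
  show "\<forall>\<^sub>F T in at_top. (\<Sum>v\<in>A T. circ (f v) ^ k) / of_nat (card (A T)) = deviation (\<lambda>z. z ^ k) T"
    using eventually_grid_gt[of k]
  proof eventually_elim
    case (elim T)
    thus ?case using assms by (simp add: deviation_def sum_roots_of_unity_power)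
  qed
qed

lemma deviation_cnj: "deviation (\<lambda>z. cnj (g z)) T = cnj (deviation g T)"
  by (simp add: deviation_def)

lemma deviation_monomial_tendsto: "(deviation (\<lambda>z. z ^ i * cnj z ^ j) \<longlongrightarrow> 0) at_top"
proof -
  have 1: "z ^ n * cnj z ^ n = 1" if "norm z = 1" for z n
    using that by (simp add: complex_norm_square[symmetric] flip: power_mult_distrib)
  consider "i = j" | "i > j" | "i < j" by linarith
  thus ?thesis
  proof cases
    case 1
    have "deviation (\<lambda>z. z ^ i * cnj z ^ j) = deviation (\<lambda>z. 1)"
      by (rule deviation_cong) (use 1 \<open>\<And>n z. norm z = 1 \<Longrightarrow> z ^ n * cnj z ^ n = 1\<close> in auto)
    moreover have "\<forall>\<^sub>F T in at_top. deviation (\<lambda>z. 1) T = 0"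
      using eventually_grid_gt[of 0] eventually_card_pos
      by eventually_elim (auto simp: deviation_def)
    ultimately show ?thesis by (simp add: tendsto_eventually)
  next
    case 2
    have "deviation (\<lambda>z. z ^ i * cnj z ^ j) = deviation (\<lambda>z. z ^ (i - j))"
    proof (rule deviation_cong)
      fix z :: complex assume "norm z = 1"
      have "z ^ i = z ^ (i - j) * z ^ j" using 2 by (simp flip: power_add)
      thus "z ^ i * cnj z ^ j = z ^ (i - j)" using 1[OF \<open>norm z = 1\<close>, of j] by simp
    qed
    thus ?thesis using 2 deviation_power_tendsto[of "i - j"] by simp
  next
    case 3
    have "deviation (\<lambda>z. z ^ i * cnj z ^ j) = deviation (\<lambda>z. cnj (z ^ (j - i)))"
    proof (rule deviation_cong)
      fix z :: complex assume "norm z = 1"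
      have "cnj z ^ j = cnj z ^ i * cnj z ^ (j - i)" using 3 by (simp flip: power_add)
      thus "z ^ i * cnj z ^ j = cnj (z ^ (j - i))" using 1[OF \<open>norm z = 1\<close>, of i]
        by (simp add: mult.assoc[symmetric])
    qed
    moreover have "((\<lambda>T. cnj (deviation (\<lambda>z. z ^ (j - i)) T)) \<longlongrightarrow> cnj 0) at_top"
      using 3 deviation_power_tendsto[of "j - i"] by (intro tendsto_cnj) auto
    ultimately show ?thesis unfolding deviation_cnj by simp
  qed
qed

text \<open>
  The property of sending admissible factors \<open>h\<close> to admissible factors is stable under
  products, in contrast to the mere convergence for the polynomial itself. This is why an arbitrary
  \<open>h\<close> is carried through the induction.
\<close>

lemma deviation_real_polynomial_multiplier:
  assumes "real_polynomial_function p"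
    and "\<And>i j. (deviation (\<lambda>z. z ^ i * cnj z ^ j * h z) \<longlongrightarrow> 0) at_top"
  shows "(deviation (\<lambda>z. z ^ i * cnj z ^ j * (of_real (p z) * h z)) \<longlongrightarrow> 0) at_top"
  using assms
proof (induction arbitrary: h i j rule: real_polynomial_function.induct)
  case (linear p)
  interpret bounded_linear p by fact
  define \<alpha> where "\<alpha> = Complex (p 1 / 2) (- p \<i> / 2)"
  have lin: "complex_of_real (p z) = \<alpha> * z + cnj \<alpha> * cnj z" for z
  proof -
    have "z = Re z *\<^sub>R 1 + Im z *\<^sub>R \<i>" by (simp add: complex_eq_iff)
    hence "p z = Re z * p 1 + Im z * p \<i>" by (metis add scaleR real_scaleR_def)
    thus ?thesis by (simp add: \<alpha>_def complex_eq_iff field_simps)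
  qed
  have "(\<lambda>z. z ^ i * cnj z ^ j * (of_real (p z) * h z)) =
      (\<lambda>z. \<alpha> * (z ^ Suc i * cnj z ^ j * h z) + cnj \<alpha> * (z ^ i * cnj z ^ Suc j * h z))"
    by (simp add: lin algebra_simps)
  thus ?case by (simp only:) (intro deviation_add_tendsto deviation_cmult_tendsto linear.prems)
next
  case (const c)
  have "(\<lambda>z. z ^ i * cnj z ^ j * (of_real c * h z)) = (\<lambda>z. of_real c * (z ^ i * cnj z ^ j * h z))"
    by (simp add: mult_ac)
  thus ?case by (simp only:) (intro deviation_cmult_tendsto const)
next
  case (add p1 p2)
  have "(\<lambda>z. z ^ i * cnj z ^ j * (of_real (p1 z + p2 z) * h z)) =
     (\<lambda>z. z ^ i * cnj z ^ j * (of_real (p1 z) * h z) + z ^ i * cnj z ^ j * (of_real (p2 z) * h z))"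
    by (simp add: algebra_simps)
  thus ?case by (simp only:) (intro deviation_add_tendsto add)
next
  case (mult p1 p2)
  have "(deviation (\<lambda>z. z ^ i * cnj z ^ j * (of_real (p1 z) * (of_real (p2 z) * h z))) \<longlongrightarrow> 0) at_top"
    by (intro mult.IH mult.prems)
  thus ?case by (simp add: mult.assoc)
qed

lemma deviation_continuous_tendsto:
  fixes g :: "complex \<Rightarrow> real"
  assumes "continuous_on (sphere 0 1) g"
  shows "(deviation (\<lambda>z. of_real (g z)) \<longlongrightarrow> 0) at_top"
proof (rule tendstoI)
  fix \<epsilon> :: real assume \<epsilon>: "\<epsilon> > 0"
  obtain p where p: "real_polynomial_function p" "\<And>z. z \<in> sphere 0 1 \<Longrightarrow> \<bar>g z - p z\<bar> < \<epsilon> / 4"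
    by (rule Stone_Weierstrass_real_polynomial_function[OF _ assms, of "\<epsilon> / 4"]) (use \<epsilon> in auto)
  have "(deviation (\<lambda>z. of_real (p z)) \<longlongrightarrow> 0) at_top"
    using deviation_real_polynomial_multiplier[OF p(1), of "\<lambda>_. 1" 0 0] deviation_monomial_tendsto by simp
  hence "eventually (\<lambda>T. dist (deviation (\<lambda>z. of_real (p z)) T) 0 < \<epsilon> / 4) at_top"
    using \<epsilon> by (intro tendstoD) auto
  thus "eventually (\<lambda>T. dist (deviation (\<lambda>z. of_real (g z)) T) 0 < \<epsilon>) at_top"
    using eventually_card_pos eventually_grid_gt[of 0]
  proof eventually_elim
    case (elim T)
    have diff: "norm (complex_of_real (g (circ x)) - of_real (p (circ x))) \<le> \<epsilon> / 4" for x
      using p(2)[of "circ x"] by (simp flip: of_real_diff)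
    have "deviation (\<lambda>z. of_real (g z)) T - deviation (\<lambda>z. of_real (p z)) T =
       (\<Sum>v\<in>A T. complex_of_real (g (circ (f v))) - of_real (p (circ (f v)))) / of_nat (card (A T)) -
       (\<Sum>j<grid T. complex_of_real (g (circ (real j / real (grid T)))) - of_real (p (circ (real j / real (grid T))))) / of_nat (card {..<grid T})"
      by (simp add: deviation_def sum_subtractf diff_divide_distrib)
    also have "norm \<dots> \<le> \<epsilon> / 4 + \<epsilon> / 4"
      by (rule order.trans[OF norm_triangle_ineq4], rule add_mono; rule norm_average_le, rule diff)
    finally have "norm (deviation (\<lambda>z. of_real (g z)) T) \<le> \<epsilon> / 4 + \<epsilon> / 4 + norm (deviation (\<lambda>z. of_real (p z)) T)"
      using norm_triangle_sub[of "deviation (\<lambda>z. of_real (g z)) T" "deviation (\<lambda>z. of_real (p z)) T"] by linarith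
    thus ?case using elim \<epsilon> by (simp add: dist_norm)
  qed
qed


text \<open>
  A continuous function that is one on the arc and zero outside a slightly larger arc dominates the
  indicator function of the first arc and is dominated by that of the second, whose grid points can be
  counted.
\<close>

lemma card_in_arc_le:
  assumes "a \<le> b" "\<epsilon> > 0"
  shows "eventually (\<lambda>T. real (card {v \<in> A T. in_arc a b (f v)}) \<le> (b - a + \<epsilon>) * real (card (A T))) at_top"
proof (cases "b - a + \<epsilon> \<ge> 1")
  case True
  have "real (card {v \<in> A T. in_arc a b (f v)}) \<le> (b - a + \<epsilon>) * real (card (A T))" for T
  proof -
    have "real (card {v \<in> A T. in_arc a b (f v)}) \<le> 1 * real (card (A T))"
      using finite_A by (simp add: card_mono)
    also have "\<dots> \<le> (b - a + \<epsilon>) * real (card (A T))" using True by (intro mult_right_mono) auto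
    finally show ?thesis .
  qed
  thus ?thesis by simp
next
  case False
  define \<delta> where "\<delta> = \<epsilon> / 4"
  have \<delta>: "\<delta> > 0" "b + \<delta> < a + 1 - \<delta>" using False assms by (simp_all add: \<delta>_def)
  let ?S = "circ ` {a..b}" and ?K = "circ ` {b + \<delta>..a + 1 - \<delta>}"
  have "?S \<inter> ?K = {}"
  proof safe
    fix x y assume xy: "x \<in> {a..b}" "y \<in> {b + \<delta>..a + 1 - \<delta>}" and "circ x = circ y"
    then obtain n :: int where n: "x = y + of_int n" by (auto simp: circ_eq_iff)
    hence "real_of_int n < 0" "real_of_int n > -1" using xy \<delta> by auto
    hence "n < 0" "n > -1" by simp_all
    hence False by linarith
    thus "circ x \<in> {}" ..
  qed
  then obtain g :: "complex \<Rightarrow> real" where g: "continuous_on UNIV g" "\<And>x. g x \<in> closed_segment 1 0"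
    "\<And>x. x \<in> ?S \<Longrightarrow> g x = 1" "\<And>x. x \<in> ?K \<Longrightarrow> g x = 0"
    using Urysohn[of ?S ?K "1::real" 0] compact_circ_image compact_imp_closed by blast
  have g01: "0 \<le> g x" "g x \<le> 1" for x
    using g(2)[of x] by (auto simp: closed_segment_eq_real_ivl)
  have "(deviation (\<lambda>z. of_real (g z)) \<longlongrightarrow> 0) at_top"
    by (intro deviation_continuous_tendsto continuous_on_subset[OF g(1)]) auto
  hence "eventually (\<lambda>T. dist (deviation (\<lambda>z. of_real (g z)) T) 0 < \<epsilon> / 4) at_top"
    using assms by (intro tendstoD) auto
  thus ?thesis
    \<comment> \<open>A grid this fine makes the rounding error \<open>1/m\<close> of the count at most \<open>\<epsilon>/4\<close>.\<close>
    using eventually_card_pos eventually_grid_gt[of "nat \<lceil>4 / \<epsilon>\<rceil>"]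
  proof eventually_elim
    case (elim T)
    define m where "m = grid T"
    define c where "c = real (card (A T))"
    have c: "c > 0" using elim by (simp add: c_def)
    have "4 / \<epsilon> < real m" using elim unfolding m_def by linarith
    hence "4 < \<epsilon> * real m" using assms by (simp add: pos_divide_less_eq mult.commute)
    moreover from this have "m > 0" by (intro gr0I) auto
    ultimately have m: "m > 0" "1 / real m \<le> \<epsilon> / 4" by (simp_all add: pos_divide_le_eq)
    have "real (card {v \<in> A T. in_arc a b (f v)}) = (\<Sum>v\<in>A T. if in_arc a b (f v) then 1 else 0)"
      using finite_A by (simp add: sum.inter_filter[symmetric])
    also have "\<dots> \<le> (\<Sum>v\<in>A T. g (circ (f v)))"
    proof (rule sum_mono)
      fix v
      show "(if in_arc a b (f v) then 1 else 0) \<le> g (circ (f v))"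
      proof (cases "in_arc a b (f v)")
        case True
        then obtain k :: int where k: "f v + of_int k \<in> {a..b}" by (auto simp: in_arc_def)
        have "circ (f v) = circ (f v + of_int k)" by simp
        hence "circ (f v) \<in> ?S" using k by blast
        thus ?thesis using g(3) True by simp
      qed (simp add: g01)
    qed
    finally have 1: "real (card {v \<in> A T. in_arc a b (f v)}) \<le> (\<Sum>v\<in>A T. g (circ (f v)))" .
    have "(\<Sum>j<m. g (circ (real j / real m))) \<le> (\<Sum>j<m. if in_arc (a - \<delta>) (b + \<delta>) (real j / real m) then 1 else 0)"
    proof (rule sum_mono)
      fix j
      define x where "x = real j / real m"
      show "g (circ x) \<le> (if in_arc (a - \<delta>) (b + \<delta>) x then 1 else 0)"
      proof (cases "in_arc (a - \<delta>) (b + \<delta>) x")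
        case False
        define k where "k = - \<lfloor>x - (a - \<delta>)\<rfloor>"
        have k: "a - \<delta> \<le> x + of_int k" "x + of_int k < a - \<delta> + 1" unfolding k_def by linarith+
        hence "x + of_int k > b + \<delta>" using False by (force simp: in_arc_def)
        hence "x + of_int k \<in> {b + \<delta>..a + 1 - \<delta>}" using k by auto
        moreover have "circ x = circ (x + of_int k)" by simp
        ultimately have "circ x \<in> ?K" by blast
        thus ?thesis using g(4) False by simp
      qed (simp add: g01)
    qed
    also have "\<dots> = real (card {j \<in> {..<m}. in_arc (a - \<delta>) (b + \<delta>) (real j / real m)})"
      by (simp only: sum.inter_filter[symmetric, OF finite_lessThan]) simp
    also have "{j \<in> {..<m}. in_arc (a - \<delta>) (b + \<delta>) (real j / real m)} = {j. j < m \<and> in_arc (a - \<delta>) (b + \<delta>) (real j / real m)}"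
      by auto
    also have "real (card \<dots>) \<le> real m * ((b + \<delta>) - (a - \<delta>)) + 1"
      using assms \<delta> m by (intro card_in_arc_equidistant_le) auto
    finally have "(\<Sum>j<m. g (circ (real j / real m))) / real m \<le> (real m * ((b + \<delta>) - (a - \<delta>)) + 1) / real m"
      by (rule divide_right_mono) simp
    also have "\<dots> = b - a + 2 * \<delta> + 1 / real m" using m by (simp add: field_simps)
    finally have 2: "(\<Sum>j<m. g (circ (real j / real m))) / real m \<le> b - a + 3 * \<epsilon> / 4"
      using m by (simp add: \<delta>_def)
    have "deviation (\<lambda>z. of_real (g z)) T = of_real ((\<Sum>v\<in>A T. g (circ (f v))) / c - (\<Sum>j<m. g (circ (real j / real m))) / real m)"
      by (simp add: deviation_def c_def m_def)
    hence "\<bar>(\<Sum>v\<in>A T. g (circ (f v))) / c - (\<Sum>j<m. g (circ (real j / real m))) / real m\<bar> < \<epsilon> / 4"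
      using elim(1) by (simp only: dist_norm diff_0_right norm_of_real)
    hence "(\<Sum>v\<in>A T. g (circ (f v))) / c \<le> b - a + \<epsilon>" using 2 by linarith
    hence "(\<Sum>v\<in>A T. g (circ (f v))) \<le> (b - a + \<epsilon>) * c" using c by (simp add: pos_divide_le_eq)
    thus ?case using 1 by (simp add: c_def)
  qed
qed

text \<open>
  Finitely many points do not matter because the families grow.
\<close>

lemma finite_negligible:
  assumes "finite E" "\<epsilon> > 0"
  shows "eventually (\<lambda>T. real (card E) \<le> \<epsilon> * real (card (A T))) at_top"
proof -
  have "eventually (\<lambda>T. real (card (A T)) \<ge> real (card E) / \<epsilon>) at_top"
    using card_A unfolding filterlim_at_top by blast
  thus ?thesis by eventually_elim (use assms in \<open>simp add: pos_divide_le_eq mult.commute\<close>)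
qed

text \<open>
  The upper bound for the arc from \<open>a\<close> to \<open>b\<close> bounds the proportion from above,
  and the upper bound for the complementary arc from \<open>b\<close> to \<open>a + 1\<close> bounds it from
  below. The complementary arc may be enlarged by \<open>\<epsilon>\<close> and finitely many points may be
  dropped.
\<close>

lemma proportion_tendsto:
  assumes ab: "a \<le> b" "b \<le> a + 1"
    and inside: "\<And>v. P v \<Longrightarrow> in_arc a b (f v)"
    and outside: "\<And>\<epsilon>. \<epsilon> > 0 \<Longrightarrow> finite {v \<in> (\<Union>T. A T). \<not> P v \<and> \<not> in_arc (b - \<epsilon>) (a + 1) (f v)}"
  shows "((\<lambda>T. real (card {v \<in> A T. P v}) / real (card (A T))) \<longlongrightarrow> b - a) at_top"
proof (rule tendstoI)
  fix \<epsilon> :: real assume \<epsilon>: "\<epsilon> > 0"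
  define \<delta> where "\<delta> = \<epsilon> / 4"
  have \<delta>: "\<delta> > 0" using \<epsilon> by (simp add: \<delta>_def)
  define E where "E = {v \<in> (\<Union>T. A T). \<not> P v \<and> \<not> in_arc (b - \<delta>) (a + 1) (f v)}"
  have finE: "finite E" unfolding E_def by (rule outside[OF \<delta>])
  have up: "eventually (\<lambda>T. real (card {v \<in> A T. in_arc a b (f v)}) \<le> (b - a + \<delta>) * real (card (A T))) at_top"
    using ab \<delta> by (intro card_in_arc_le) auto
  have lo: "eventually (\<lambda>T. real (card {v \<in> A T. in_arc (b - \<delta>) (a + 1) (f v)}) \<le> (a + 1 - (b - \<delta>) + \<delta>) * real (card (A T))) at_top"
    using ab \<delta> by (intro card_in_arc_le) auto
  show "eventually (\<lambda>T. dist (real (card {v \<in> A T. P v}) / real (card (A T))) (b - a) < \<epsilon>) at_top"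
    using up lo finite_negligible[OF finE \<delta>] eventually_card_pos
  proof eventually_elim
    case (elim T)
    define c p where "c = real (card (A T))" and "p = real (card {v \<in> A T. P v})"
    have c: "c > 0" using elim by (simp add: c_def)
    have "card {v \<in> A T. P v} \<le> card {v \<in> A T. in_arc a b (f v)}"
      using inside finite_A by (intro card_mono) auto
    hence "p \<le> (b - a + \<delta>) * c" using elim unfolding p_def c_def by linarith
    moreover have "card (A T) \<le> card {v \<in> A T. P v} + (card {v \<in> A T. in_arc (b - \<delta>) (a + 1) (f v)} + card E)"
    proof -
      have "card (A T) \<le> card ({v \<in> A T. P v} \<union> ({v \<in> A T. in_arc (b - \<delta>) (a + 1) (f v)} \<union> E))"
        using finite_A finE by (intro card_mono) (auto simp: E_def)
      also have "\<dots> \<le> card {v \<in> A T. P v} + (card {v \<in> A T. in_arc (b - \<delta>) (a + 1) (f v)} + card E)"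
        by (meson add_left_mono card_Un_le order.trans)
      finally show ?thesis .
    qed
    hence "c \<le> p + ((a + 1 - (b - \<delta>) + \<delta>) * c + \<delta> * c)"
      using elim unfolding p_def c_def by linarith
    hence "(b - a - 3 * \<delta>) * c \<le> p" by (simp add: algebra_simps)
    ultimately have "b - a - 3 * \<delta> \<le> p / c" "p / c \<le> b - a + \<delta>"
      using c by (simp_all add: pos_le_divide_eq pos_divide_le_eq)
    hence "\<bar>p / c - (b - a)\<bar> < \<epsilon>" using \<epsilon> by (simp add: \<delta>_def abs_if)
    thus ?case unfolding p_def c_def dist_real_def .
  qed
qed

end

lemma average_null_tendsto:
  fixes A :: "real \<Rightarrow> 'a set" and g :: "'a \<Rightarrow> complex"
  assumes card_A: "filterlim (\<lambda>T. real (card (A T))) at_top at_top"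
    and finite_A: "\<And>T. finite (A T)"
    and null: "\<And>\<epsilon>. \<epsilon> > 0 \<Longrightarrow> finite {v \<in> (\<Union>T. A T). norm (g v) > \<epsilon>}"
  shows "((\<lambda>T. (\<Sum>v\<in>A T. g v) / of_nat (card (A T))) \<longlongrightarrow> 0) at_top"
proof (rule tendstoI)
  fix \<epsilon> :: real assume \<epsilon>: "\<epsilon> > 0"
  define E where "E = {v \<in> (\<Union>T. A T). norm (g v) > \<epsilon> / 4}"
  have E: "finite E" unfolding E_def using \<epsilon> by (intro null) auto
  define C where "C = (\<Sum>v\<in>E. norm (g v))"
  have "eventually (\<lambda>T. real (card (A T)) \<ge> 4 * C / \<epsilon>) at_top" "eventually (\<lambda>T. real (card (A T)) \<ge> 1) at_top"
    using card_A unfolding filterlim_at_top by blast+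
  thus "eventually (\<lambda>T. dist ((\<Sum>v\<in>A T. g v) / of_nat (card (A T))) 0 < \<epsilon>) at_top"
  proof eventually_elim
    case (elim T)
    define c where "c = real (card (A T))"
    have c: "c \<ge> 1" "C \<le> \<epsilon> / 4 * c" using elim \<epsilon> by (simp_all add: c_def field_simps)
    have "norm (\<Sum>v\<in>A T. g v) \<le> (\<Sum>v\<in>A T. norm (g v))" by (rule norm_sum)
    also have "\<dots> \<le> (\<Sum>v\<in>A T. (if v \<in> E then norm (g v) else 0) + \<epsilon> / 4)"
      using \<epsilon> by (intro sum_mono) (auto simp: E_def)
    also have "\<dots> = (\<Sum>v\<in>A T \<inter> E. norm (g v)) + \<epsilon> / 4 * c"
      using finite_A by (simp add: sum.distrib sum.inter_restrict c_def)
    also have "(\<Sum>v\<in>A T \<inter> E. norm (g v)) \<le> C"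
      unfolding C_def using E by (intro sum_mono2) auto
    finally have "norm (\<Sum>v\<in>A T. g v) \<le> \<epsilon> / 2 * c" using c by linarith
    also have "\<dots> < \<epsilon> * c" using \<epsilon> c by simp
    finally show ?case using c by (simp add: norm_divide c_def pos_divide_less_eq)
  qed
qed

section \<open>Bases of plane lattices\<close>

lemma zmod_span_pair: "zmod.span {v, v'} = {of_int a * v + of_int b * v' | a b. True}"
proof -
  have "x \<in> zmod.span {v, v'} \<longleftrightarrow> (\<exists>a b. x = of_int a * v + of_int b * v')" for x
  proof -
    have "x \<in> zmod.span {v, v'} \<longleftrightarrow> (\<exists>a. x - of_int a * v \<in> zmod.span {v'})"
      by (simp only: zmod.span_insert[of v "{v'}"] mem_Collect_eq)
    also have "\<dots> \<longleftrightarrow> (\<exists>a b. x - of_int a * v = of_int b * v')"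
      by (simp only: zmod.span_singleton image_iff) auto
    finally show ?thesis by (simp only: diff_eq_eq add.commute)
  qed
  thus ?thesis by auto
qed

lemma is_Z_basis_iff:
  "is_Z_basis L v v' \<longleftrightarrow> (\<forall>a b. of_int a * v + of_int b * v' = 0 \<longrightarrow> a = 0 \<and> b = 0) \<and>
     L = {of_int a * v + of_int b * v' | a b. True}"
proof -
  have indep: "zmod.independent {v, v'} \<longleftrightarrow> (\<forall>a b. of_int a * v + of_int b * v' = 0 \<longrightarrow> a = 0 \<and> b = 0)"
    if "v \<noteq> v'"
  proof -
    have "zmod.dependent {v, v'} \<longleftrightarrow> (\<exists>u. (u v \<noteq> 0 \<or> u v' \<noteq> 0) \<and> of_int (u v) * v + of_int (u v') * v' = 0)"
      using that by (subst zmod.dependent_finite) auto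
    also have "\<dots> \<longleftrightarrow> (\<exists>a b. (a \<noteq> 0 \<or> b \<noteq> 0) \<and> of_int a * v + of_int b * v' = 0)"
    proof
      assume "\<exists>a b. (a \<noteq> 0 \<or> b \<noteq> 0) \<and> of_int a * v + of_int b * v' = 0"
      then obtain a b where "a \<noteq> 0 \<or> b \<noteq> 0" "of_int a * v + of_int b * v' = 0" by blast
      thus "\<exists>u. (u v \<noteq> 0 \<or> u v' \<noteq> 0) \<and> of_int (u v) * v + of_int (u v') * v' = 0"
        using that by (intro exI[of _ "\<lambda>z. if z = v then a else b"]) auto
    qed blast
    finally show ?thesis by auto
  qed
  have "v \<noteq> v'" if "\<forall>a b. of_int a * v + of_int b * v' = 0 \<longrightarrow> a = 0 \<and> b = 0"
  proof
    assume "v = v'"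
    hence "of_int 1 * v + of_int (-1) * v' = 0" by simp
    with that have "(1::int) = 0" by blast
    thus False by simp
  qed
  thus ?thesis unfolding is_Z_basis_def zmod_span_pair using indep by auto
qed

lemma lattice_combination:
  assumes "complex_lattice L" "u \<in> L" "w \<in> L"
  shows "of_int a * u + of_int b * w \<in> L"
  using assms zmod.subspace_add zmod.subspace_scale unfolding complex_lattice_def by metis

lemma lattice_finite_in_ball:
  assumes "complex_lattice L"
  shows "finite {v \<in> L. norm v \<le> R}"
proof -
  have "0 \<in> L" using assms by (auto simp: complex_lattice_def zmod.subspace_0)
  then obtain e where e: "e > 0" "\<And>y. y \<in> L \<Longrightarrow> dist 0 y < e \<Longrightarrow> y = 0"
    using assms unfolding complex_lattice_def discrete_def isolated_in_dist_Ex_iff by blast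
  have "uniform_discrete {v \<in> L. norm v \<le> R}"
    unfolding uniform_discrete_def
  proof (intro exI[of _ e] conjI ballI impI e(1))
    fix x y assume xy: "x \<in> {v \<in> L. norm v \<le> R}" "y \<in> {v \<in> L. norm v \<le> R}" "dist x y < e"
    have "x - y \<in> L" using lattice_combination[OF assms, of x y 1 "-1"] xy by simp
    thus "x = y" using e(2)[of "x - y"] xy(3) by (simp add: dist_norm norm_minus_commute)
  qed
  moreover have "bounded {v \<in> L. norm v \<le> R}" by (auto simp: bounded_iff)
  ultimately show ?thesis using uniform_discrete_finite_iff by blast
qed

lemma lattice_shortest:
  assumes "complex_lattice L" "S \<subseteq> L" "u \<in> S"
  obtains x where "x \<in> S" "\<And>y. y \<in> S \<Longrightarrow> norm x \<le> norm y"
proof -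
  let ?F = "{v \<in> S. norm v \<le> norm u}"
  have "finite ?F" by (rule finite_subset[OF _ lattice_finite_in_ball[OF assms(1), of "norm u"]]) (use assms in auto)
  then obtain x where x: "x \<in> ?F" "\<And>y. y \<in> ?F \<Longrightarrow> norm x \<le> norm y"
    using ex_is_arg_min_if_finite[of ?F norm] assms(3) unfolding is_arg_min_linorder by force
  show ?thesis
  proof
    show "x \<in> S" using x by simp
    fix y assume "y \<in> S"
    thus "norm x \<le> norm y" using x(1) x(2)[of y] by (cases "norm y \<le> norm u") auto
  qed
qed

lemma real_coordinates:
  assumes "Im (cnj w1 * w2) \<noteq> 0"
  shows "v = of_real (Im (cnj v * w2) / Im (cnj w1 * w2)) * w1 + of_real (Im (cnj w1 * v) / Im (cnj w1 * w2)) * w2"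
proof -
  define D p q where "D = Im (cnj w1 * w2)" and "p = Im (cnj v * w2)" and "q = Im (cnj w1 * v)"
  have "of_real D * v = of_real p * w1 + of_real q * w2"
    by (simp add: D_def p_def q_def complex_eq_iff algebra_simps)
  hence "v = (of_real p * w1 + of_real q * w2) / of_real D"
    using assms by (simp only: D_def[symmetric]) (metis nonzero_mult_div_cancel_left of_real_eq_0_iff)
  also have "\<dots> = of_real (p / D) * w1 + of_real (q / D) * w2"
    by (simp only: add_divide_distrib of_real_divide times_divide_eq_left)
  finally show ?thesis by (simp only: D_def p_def q_def)
qed

text \<open>
  If \<open>w = t u\<close> with \<open>t\<close> real, then the lattice vectors \<open>k w - floor (k t)
  u\<close> all lie in the disc of radius \<open>|u|\<close>. There are finitely many lattice vectors in the
  disc, so two of these coincide, which is a linear relation between \<open>u\<close> and \<open>w\<close>.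
\<close>

lemma lattice_independent_det:
  assumes L: "complex_lattice L" and uw: "u \<in> L" "w \<in> L"
    and indep: "\<And>a b. of_int a * u + of_int b * w = 0 \<Longrightarrow> a = 0 \<and> b = 0"
  shows "Im (cnj u * w) \<noteq> 0"
proof
  assume zero: "Im (cnj u * w) = 0"
  have u0: "u \<noteq> 0" using indep[of 1 0] by auto
  define t where "t = Re (w / u)"
  have "Im (w / u) = 0" using zero by (simp add: Im_divide algebra_simps)
  hence "w / u = of_real t" by (simp add: t_def complex_eq_iff)
  hence w: "w = of_real t * u" using u0 by (simp add: field_simps)
  define g where "g k = of_int (- \<lfloor>real k * t\<rfloor>) * u + of_int (int k) * w" for k
  have "g k \<in> {v \<in> L. norm v \<le> norm u}" for k
  proof -
    have "g k = of_real (frac (real k * t)) * u"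
      by (simp add: g_def w frac_def algebra_simps)
    hence "norm (g k) = frac (real k * t) * norm u" by (simp add: norm_mult)
    also have "\<dots> \<le> 1 * norm u"
      using frac_lt_1[of "real k * t"] by (intro mult_right_mono) auto
    finally have "norm (g k) \<le> norm u" by simp
    moreover have "g k \<in> L" unfolding g_def by (rule lattice_combination[OF L uw])
    ultimately show ?thesis by simp
  qed
  hence "finite (range g)"
    by (intro finite_subset[OF _ lattice_finite_in_ball[OF L, of "norm u"]]) auto
  hence "\<not> inj g" using finite_imageD infinite_UNIV_nat by blast
  then obtain k k' where k: "g k = g k'" "k \<noteq> k'" by (auto simp: inj_def)
  have "of_int (\<lfloor>real k' * t\<rfloor> - \<lfloor>real k * t\<rfloor>) * u + of_int (int k - int k') * w = g k - g k'"
    by (simp add: g_def algebra_simps)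
  hence "int k - int k' = 0" using indep k by (metis cancel_comm_monoid_add_class.diff_cancel)
  thus False using k by simp
qed

text \<open>
  Take \<open>w1\<close> shortest among the nonzero vectors and \<open>w2\<close> shortest among those off
  the real line through \<open>w1\<close>. Subtracting integer multiples of both from a lattice vector
  leaves real coordinates of size at most \<open>1/2\<close>, and the remainder is too short to be different
  from zero.
\<close>

lemma lattice_has_reduced_basis:
  assumes L: "complex_lattice L"
  obtains w1 w2 where "Im (cnj w1 * w2) > 0" "L = {of_int a * w1 + of_int b * w2 | a b. True}"
proof -
  obtain B where B: "B \<subseteq> L" "zmod.independent B" "card B = 2"
    using L unfolding complex_lattice_def has_rank_def by blast
  then obtain u w where uw: "B = {u, w}" "u \<noteq> w" by (auto simp: card_2_iff)
  have "is_Z_basis (zmod.span {u, w}) u w"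
    using B uw by (simp add: is_Z_basis_def)
  hence "Im (cnj u * w) \<noteq> 0"
    using B uw unfolding is_Z_basis_iff by (intro lattice_independent_det[OF L]) auto
  have uwL: "u \<in> L" "w \<in> L" using B uw by auto
  have "u \<noteq> 0" using \<open>Im (cnj u * w) \<noteq> 0\<close> by auto
  obtain w1 where w1: "w1 \<in> L - {0}" "\<And>y. y \<in> L - {0} \<Longrightarrow> norm w1 \<le> norm y"
    by (rule lattice_shortest[OF L, of "L - {0}" u]) (use uwL \<open>u \<noteq> 0\<close> in auto)
  let ?S = "{v \<in> L. Im (cnj w1 * v) \<noteq> 0}"
  have "u \<in> ?S \<or> w \<in> ?S"
  proof (rule ccontr)
    assume "\<not> ?thesis"
    hence z: "Im (cnj w1 * u) = 0" "Im (cnj w1 * w) = 0" using uwL by auto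
    have "(norm w1)\<^sup>2 * Im (cnj u * w) =
        Re (cnj w1 * u) * Im (cnj w1 * w) - Im (cnj w1 * u) * Re (cnj w1 * w)"
      unfolding cmod_power2 by (simp add: power2_eq_square algebra_simps)
    hence "(norm w1)\<^sup>2 * Im (cnj u * w) = 0" by (simp only: z)
    thus False using w1 \<open>Im (cnj u * w) \<noteq> 0\<close> by simp
  qed
  then obtain u' where "u' \<in> ?S" by blast
  obtain w2 where w2: "w2 \<in> ?S" "\<And>y. y \<in> ?S \<Longrightarrow> norm w2 \<le> norm y"
    by (rule lattice_shortest[OF L, of ?S u']) (use \<open>u' \<in> ?S\<close> in auto)
  define D where "D = Im (cnj w1 * w2)"
  have D: "D \<noteq> 0" using w2 by (simp add: D_def)
  have wL: "w1 \<in> L" "w2 \<in> L" "w1 \<noteq> 0" using w1 w2 by auto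
  have w12: "norm w1 \<le> norm w2" using w1(2)[of w2] w2(1) by force
  have span: "\<exists>a b. v = of_int a * w1 + of_int b * w2" if v: "v \<in> L" for v
  proof -
    define x y where "x = Im (cnj v * w2) / D" and "y = Im (cnj w1 * v) / D"
    have vxy: "v = of_real x * w1 + of_real y * w2"
      using real_coordinates[of w1 w2 v] D by (simp add: x_def y_def D_def)
    define x' y' where "x' = x - of_int (round x)" and "y' = y - of_int (round y)"
    have xy': "\<bar>x'\<bar> \<le> 1/2" "\<bar>y'\<bar> \<le> 1/2"
      using of_int_round_abs_le[of x] of_int_round_abs_le[of y] by (simp_all add: x'_def y'_def abs_minus_commute)
    define v0 where "v0 = v - of_int (round x) * w1 - of_int (round y) * w2"
    have v0: "v0 = of_real x' * w1 + of_real y' * w2"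
      by (simp add: v0_def vxy x'_def y'_def algebra_simps)
    have v0L: "v0 \<in> L"
    proof -
      have "v0 = of_int 1 * v + of_int 1 * (of_int (- round x) * w1 + of_int (- round y) * w2)"
        by (simp add: v0_def)
      also have "\<dots> \<in> L" by (intro lattice_combination[OF L] v wL)
      finally show ?thesis .
    qed
    have le1: "norm (of_real x' * w1) \<le> 1/2 * norm w1" "norm (of_real y' * w2) \<le> 1/2 * norm w2"
      unfolding norm_mult norm_of_real using xy' by (intro mult_right_mono; simp)+
    have "y' = 0"
    proof (rule ccontr)
      assume y0: "y' \<noteq> 0"
      have "Im (cnj w1 * v0) = y' * D"
        by (simp add: v0 D_def algebra_simps)
      hence ge: "norm w2 \<le> norm v0" using y0 D v0L by (intro w2(2)) auto
      \<comment> \<open>Minimality of \<open>w2\<close> forces equality in the triangle inequality, hence parallel summands.\<close>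
      have "norm v0 \<le> norm (of_real x' * w1) + norm (of_real y' * w2)" unfolding v0 by (rule norm_triangle_ineq)
      hence eq: "norm (of_real x' * w1 + of_real y' * w2) = norm (of_real x' * w1) + norm (of_real y' * w2)"
        and full: "norm (of_real x' * w1) = 1/2 * norm w1"
        using ge le1 w12 unfolding v0 by linarith+
      have x0: "x' \<noteq> 0" using full wL by auto
      have "norm (of_real x' * w1) *\<^sub>R (of_real y' * w2) = norm (of_real y' * w2) *\<^sub>R (of_real x' * w1)"
        using eq by (simp only: norm_triangle_eq)
      hence "Im (cnj w1 * (norm (of_real x' * w1) *\<^sub>R (of_real y' * w2))) = Im (cnj w1 * (norm (of_real y' * w2) *\<^sub>R (of_real x' * w1)))"
        by simp
      moreover have "Im (cnj w1 * (norm (of_real x' * w1) *\<^sub>R (of_real y' * w2))) = norm (of_real x' * w1) * y' * D"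
        by (simp add: D_def algebra_simps)
      moreover have "Im (cnj w1 * (norm (of_real y' * w2) *\<^sub>R (of_real x' * w1))) = 0"
        by (simp add: algebra_simps)
      ultimately show False using x0 y0 D wL by (simp add: D_def)
    qed
    hence "norm v0 \<le> 1/2 * norm w1" using le1 v0 by simp
    moreover have "norm w1 > 0" using wL by simp
    ultimately have "norm v0 < norm w1" by linarith
    hence "v0 = 0" using w1(2)[of v0] v0L by (cases "v0 = 0") auto
    thus ?thesis unfolding v0_def by (intro exI[of _ "round x"] exI[of _ "round y"]) (simp add: algebra_simps)
  qed
  define w2' where "w2' = (if D > 0 then w2 else - w2)"
  show ?thesis
  proof
    show "Im (cnj w1 * w2') > 0" using D by (auto simp: w2'_def D_def)
    show "L = {of_int a * w1 + of_int b * w2' | a b. True}"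
    proof (intro equalityI subsetI)
      fix v assume "v \<in> L"
      then obtain a b where ab: "v = of_int a * w1 + of_int b * w2" using span by blast
      hence "v = of_int a * w1 + of_int (if D > 0 then b else - b) * w2'" by (simp add: w2'_def)
      thus "v \<in> {of_int a * w1 + of_int b * w2' | a b. True}" by blast
    next
      fix v assume "v \<in> {of_int a * w1 + of_int b * w2' | a b. True}"
      then obtain a b where "v = of_int a * w1 + of_int b * w2'" by blast
      hence "v = of_int a * w1 + of_int (if D > 0 then b else - b) * w2" by (simp add: w2'_def)
      thus "v \<in> L" using lattice_combination[OF L] wL by blast
    qed
  qed
qed

section \<open>Coprime pairs\<close>

lemma sum_inverse_squares_le: "(\<Sum>d\<in>{2..n}. 1 / (real d)\<^sup>2) \<le> 3/4"
proof -
  \<comment> \<open>The correction \<open>1/n\<close> makes the bound inductive, by comparison with a telescoping sum.\<close>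
  have "(\<Sum>d\<in>{2..n}. 1 / (real d)\<^sup>2) \<le> 3/4 - 1 / real n" if "n \<ge> 2" for n
    using that
  proof (induction n rule: dec_induct)
    case (step n)
    have "1 / (real (Suc n))\<^sup>2 \<le> 1 / real n - 1 / real (Suc n)"
    proof -
      have n: "real n > 0" using step by simp
      hence "1 / (real (Suc n))\<^sup>2 \<le> 1 / (real n * real (Suc n))"
        by (intro divide_left_mono) (auto simp: power2_eq_square)
      also have "\<dots> = 1 / real n - 1 / real (Suc n)" using n by (simp add: field_simps)
      finally show ?thesis .
    qed
    thus ?case using step by simp
  qed simp
  note le = this
  show ?thesis
  proof (cases "n \<ge> 2")
    case True
    have "1 / real n \<ge> 0" by simp
    thus ?thesis using le[OF True] by linarith
  qed simp
qed

text \<open>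
  A pair that is not coprime consists of two multiples of some \<open>d \<ge> 2\<close>. There are at most
  \<open>(n/d)^2\<close> such pairs for each \<open>d\<close>, together at most \<open>3/4 n^2\<close>, so
  crude counting without inclusion-exclusion suffices.
\<close>

lemma card_coprime_pairs_ge:
  "real (card {(a, b). a \<in> {1..n} \<and> b \<in> {1..n} \<and> coprime a b}) \<ge> (real n)\<^sup>2 / 4"
proof -
  let ?C = "{(a, b). a \<in> {1..n} \<and> b \<in> {1..n} \<and> coprime a b}"
  define Mu where "Mu d = {a \<in> {1..n}. d dvd a}" for d :: nat
  have cardMu: "real (card (Mu d)) \<le> real n / real d" if "d \<ge> 2" for d
  proof -
    have "card (Mu d) \<le> card {1..n div d}"
    proof (rule card_inj_on_le[of "\<lambda>a. a div d"])
      show "inj_on (\<lambda>a. a div d) (Mu d)"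
        by (rule inj_onI) (metis (mono_tags, lifting) Mu_def dvd_div_mult_self mem_Collect_eq)
      show "(\<lambda>a. a div d) ` Mu d \<subseteq> {1..n div d}"
      proof (rule image_subsetI)
        fix a assume a: "a \<in> Mu d"
        hence "d \<le> a" by (auto simp: Mu_def intro: dvd_imp_le)
        hence "a div d > 0" using that by (simp add: div_greater_zero_iff)
        moreover have "a div d \<le> n div d" using a by (intro div_le_mono) (auto simp: Mu_def)
        ultimately show "a div d \<in> {1..n div d}" by simp
      qed
    qed simp
    hence "real (card (Mu d)) \<le> real (n div d)" by simp
    also have "\<dots> \<le> real n / real d" by (rule of_nat_div_le_of_nat)
    finally show ?thesis .
  qed
  have fin: "finite (Mu d)" for d by (simp add: Mu_def)
  have finC: "finite ?C" by (rule finite_subset[of _ "{1..n} \<times> {1..n}"]) auto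
  have "{1..n} \<times> {1..n} \<subseteq> ?C \<union> (\<Union>d\<in>{2..n}. Mu d \<times> Mu d)"
  proof safe
    fix a b assume ab: "a \<in> {1..n}" "b \<in> {1..n}" "(a, b) \<notin> (\<Union>d\<in>{2..n}. Mu d \<times> Mu d)"
    have "gcd a b \<le> a" using ab by (intro gcd_le1_nat) auto
    moreover have "a \<le> n" using ab by simp
    ultimately have "gcd a b \<le> n" by linarith
    moreover have "gcd a b \<notin> {2..n}" using ab unfolding Mu_def by force
    ultimately have "gcd a b < 2" by simp
    moreover have "gcd a b > 0" using ab by simp
    ultimately have "gcd a b = 1" by linarith
    thus "coprime a b" by (simp only: coprime_iff_gcd_eq_1)
  qed
  hence "card ({1..n} \<times> {1..n}) \<le> card (?C \<union> (\<Union>d\<in>{2..n}. Mu d \<times> Mu d))"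
    by (rule card_mono[rotated]) (intro finite_UnI finite_UN_I finite_cartesian_product fin finC finite_atLeastAtMost)
  also have "\<dots> \<le> card ?C + (\<Sum>d\<in>{2..n}. card (Mu d \<times> Mu d))"
    by (intro order.trans[OF card_Un_le] add_left_mono card_UN_le) simp
  finally have "n * n \<le> card ?C + (\<Sum>d\<in>{2..n}. card (Mu d) * card (Mu d))" by (simp add: card_cartesian_product)
  hence "real (n * n) \<le> real (card ?C + (\<Sum>d\<in>{2..n}. card (Mu d) * card (Mu d)))" by (rule of_nat_mono)
  also have "\<dots> = real (card ?C) + (\<Sum>d\<in>{2..n}. real (card (Mu d)) * real (card (Mu d)))" by simp
  also have "(\<Sum>d\<in>{2..n}. real (card (Mu d)) * real (card (Mu d))) \<le> (\<Sum>d\<in>{2..n}. (real n / real d) * (real n / real d))"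
    by (intro sum_mono mult_mono cardMu) auto
  also have "\<dots> = (real n)\<^sup>2 * (\<Sum>d\<in>{2..n}. 1 / (real d)\<^sup>2)"
    by (simp add: sum_distrib_left power2_eq_square)
  also have "\<dots> \<le> (real n)\<^sup>2 * (3/4)" by (intro mult_left_mono sum_inverse_squares_le) auto
  finally show ?thesis by (simp add: power2_eq_square)
qed

section \<open>Primitive vectors in coordinates\<close>

locale oriented_lattice =
  fixes L :: "complex set" and w1 w2 :: complex
  assumes L_eq: "L = {of_int a * w1 + of_int b * w2 | a b. True}"
    and det_pos: "Im (cnj w1 * w2) > 0"
begin

definition covol :: real where "covol = Im (cnj w1 * w2)"

definition vec :: "int \<Rightarrow> int \<Rightarrow> complex" where
  "vec a b = of_int a * w1 + of_int b * w2"

lemma covol_pos: "covol > 0" using det_pos by (simp add: covol_def)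

lemma vec_in_L [simp]: "vec a b \<in> L"
  unfolding L_eq vec_def by blast

lemma vec_cases: "v \<in> L \<Longrightarrow> (\<And>a b. v = vec a b \<Longrightarrow> thesis) \<Longrightarrow> thesis"
  unfolding L_eq vec_def by blast

lemma vec_combination: "of_int p * vec a b + of_int q * vec c d = vec (p * a + q * c) (p * b + q * d)"
  by (simp add: vec_def algebra_simps)

text \<open>
  The signed area spanned by two lattice vectors is the determinant of their coordinates times the covolume.
  Most facts about bases are read off from this.
\<close>

lemma Im_cnj_vec_mult_vec: "Im (cnj (vec a b) * vec c d) = of_int (a * d - b * c) * covol"
  by (simp add: vec_def covol_def algebra_simps)

lemma vec_eq_iff: "vec a b = vec c d \<longleftrightarrow> a = c \<and> b = d"
proof
  assume eq: "vec a b = vec c d"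
  have "Im (cnj (vec 1 0) * vec a b) = Im (cnj (vec 1 0) * vec c d)" "Im (cnj (vec a b) * vec 0 1) = Im (cnj (vec c d) * vec 0 1)"
    using eq by simp_all
  thus "a = c \<and> b = d" unfolding Im_cnj_vec_mult_vec using covol_pos by simp
qed simp

lemma vec_0: "vec 0 0 = 0" by (simp add: vec_def)

text \<open>
  Expressing \<open>w1\<close> and \<open>w2\<close> in terms of a basis inverts its coordinate matrix over
  the integers, so the determinant is a unit; conversely the adjugate matrix times the determinant is the
  inverse.
\<close>

lemma is_Z_basis_vec_iff: "is_Z_basis L (vec a b) (vec c d) \<longleftrightarrow> \<bar>a * d - b * c\<bar> = 1"
proof
  assume basis: "is_Z_basis L (vec a b) (vec c d)"
  hence span: "\<exists>p q. v = of_int p * vec a b + of_int q * vec c d" if "v \<in> L" for v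
    using that unfolding is_Z_basis_iff by blast
  obtain p q where pq: "vec 1 0 = vec (p * a + q * c) (p * b + q * d)"
    using span[of "vec 1 0"] unfolding vec_combination by auto
  obtain r s where rs: "vec 0 1 = vec (r * a + s * c) (r * b + s * d)"
    using span[of "vec 0 1"] unfolding vec_combination by auto
  have "(p * s - q * r) * (a * d - b * c) = (p * a + q * c) * (r * b + s * d) - (p * b + q * d) * (r * a + s * c)"
    by (simp add: algebra_simps)
  also have "\<dots> = 1" using pq rs by (simp add: vec_eq_iff)
  finally have "\<bar>a * d - b * c\<bar> dvd 1" by (metis abs_dvd_iff dvd_triv_right)
  thus "\<bar>a * d - b * c\<bar> = 1" by simp
next
  define D where "D = a * d - b * c"
  assume "\<bar>a * d - b * c\<bar> = 1"
  hence DD: "D * D = 1" "D \<noteq> 0" by (auto simp: D_def[symmetric] abs_if split: if_splits)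
  show "is_Z_basis L (vec a b) (vec c d)"
    unfolding is_Z_basis_iff
  proof (intro conjI allI impI)
    fix p q :: int assume "of_int p * vec a b + of_int q * vec c d = 0"
    hence e: "p * a + q * c = 0" "p * b + q * d = 0" unfolding vec_combination vec_0[symmetric] vec_eq_iff by auto
    have "p * D = d * (p * a + q * c) - c * (p * b + q * d)" "q * D = a * (p * b + q * d) - b * (p * a + q * c)"
      by (simp_all add: D_def algebra_simps)
    hence "p * D = 0" "q * D = 0" unfolding e by simp_all
    thus "p = 0" "q = 0" using DD by simp_all
  next
    show "L = {of_int p * vec a b + of_int q * vec c d | p q. True}"
    proof (intro equalityI subsetI)
      fix v assume "v \<in> L"
      then obtain x y where v: "v = vec x y" by (rule vec_cases)
      have "D * (x * d - y * c) * a + D * (y * a - x * b) * c = x * (D * D)"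
        "D * (x * d - y * c) * b + D * (y * a - x * b) * d = y * (D * D)"
        by (simp_all add: D_def algebra_simps)
      hence "v = of_int (D * (x * d - y * c)) * vec a b + of_int (D * (y * a - x * b)) * vec c d"
        unfolding vec_combination v vec_eq_iff using DD by simp
      thus "v \<in> {of_int p * vec a b + of_int q * vec c d | p q. True}" by blast
    qed (auto simp: vec_combination)
  qed
qed

lemma primitive_vector_vec_iff: "primitive_vector L (vec a b) \<longleftrightarrow> coprime a b"
proof
  assume "primitive_vector L (vec a b)"
  then obtain v' where v': "is_Z_basis L (vec a b) v'" by (auto simp: primitive_vector_def)
  hence "v' \<in> L" unfolding is_Z_basis_def using zmod.span_superset[of "{vec a b, v'}"] by auto
  then obtain c d where "v' = vec c d" by (rule vec_cases)
  with v' have D: "\<bar>a * d - b * c\<bar> = 1" by (simp add: is_Z_basis_vec_iff)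
  show "coprime a b"
  proof (rule coprimeI)
    fix e assume "e dvd a" "e dvd b"
    hence "e dvd \<bar>a * d - b * c\<bar>" by simp
    thus "is_unit e" using D by simp
  qed
next
  assume "coprime a b"
  moreover obtain x y where "x * a + y * b = gcd a b" using bezout_int by blast
  ultimately have "a * x - b * (- y) = 1" by (simp add: algebra_simps)
  hence "is_Z_basis L (vec a b) (vec (- y) x)" by (simp only: is_Z_basis_vec_iff)
  thus "primitive_vector L (vec a b)" by (auto simp: primitive_vector_def)
qed

lemma coprime_vec_neq_0: "coprime a b \<Longrightarrow> vec a b \<noteq> 0"
  unfolding vec_0[symmetric] vec_eq_iff by auto

lemma Im_vec_divide: "Im (vec c d / vec a b) = of_int (a * d - b * c) * covol / (norm (vec a b))\<^sup>2"
proof -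
  have "Im (vec c d / vec a b) = Im (cnj (vec a b) * vec c d) / (norm (vec a b))\<^sup>2"
    by (simp add: complex_div_cnj[of "vec c d"] mult.commute)
  thus ?thesis by (simp only: Im_cnj_vec_mult_vec)
qed

lemma oriented_completion_vec_iff:
  assumes "coprime a b"
  shows "oriented_completion L (vec a b) (vec c d) \<longleftrightarrow> a * d - b * c = 1"
proof -
  have "Im (vec c d / vec a b) > 0 \<longleftrightarrow> of_int (a * d - b * c) > (0::real)"
    unfolding Im_vec_divide using covol_pos coprime_vec_neq_0[OF assms]
    by (simp add: zero_less_divide_iff zero_less_mult_iff)
  hence "Im (vec c d / vec a b) > 0 \<longleftrightarrow> a * d - b * c > 0" by (simp only: of_int_0_less_iff)
  thus ?thesis unfolding oriented_completion_def is_Z_basis_vec_iff by auto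
qed

definition coord_const :: real where "coord_const = (norm w1 + norm w2) / covol"

lemma coordinates_bounded:
  "\<bar>of_int a\<bar> \<le> coord_const * norm (vec a b)"
  "\<bar>of_int b\<bar> \<le> coord_const * norm (vec a b)"
proof -
  have "\<bar>of_int b\<bar> * covol = \<bar>Im (cnj (vec 1 0) * vec a b)\<bar>"
    unfolding Im_cnj_vec_mult_vec using covol_pos by (simp add: abs_mult)
  also have "\<dots> \<le> norm w1 * norm (vec a b)"
    by (rule order.trans[OF abs_Im_le_cmod]) (simp add: norm_mult vec_def)
  also have "\<dots> \<le> (norm w1 + norm w2) * norm (vec a b)" by (intro mult_right_mono) auto
  finally show "\<bar>of_int b\<bar> \<le> coord_const * norm (vec a b)"
    using covol_pos by (simp add: coord_const_def pos_le_divide_eq)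
  have "\<bar>of_int a\<bar> * covol = \<bar>Im (cnj (vec a b) * vec 0 1)\<bar>"
    unfolding Im_cnj_vec_mult_vec using covol_pos by (simp add: abs_mult)
  also have "\<dots> \<le> norm w2 * norm (vec a b)"
  proof (rule order.trans[OF abs_Im_le_cmod])
    have "vec 0 1 = w2" by (simp add: vec_def)
    thus "norm (cnj (vec a b) * vec 0 1) \<le> norm w2 * norm (vec a b)"
      by (simp only: norm_mult complex_mod_cnj mult.commute order_refl)
  qed
  also have "\<dots> \<le> (norm w1 + norm w2) * norm (vec a b)" by (intro mult_right_mono) auto
  finally show "\<bar>of_int a\<bar> \<le> coord_const * norm (vec a b)"
    using covol_pos by (simp add: coord_const_def pos_le_divide_eq)
qed

lemma coord_const_nonneg: "coord_const \<ge> 0"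
  using covol_pos by (simp add: coord_const_def)

lemma coordinates_le:
  assumes "norm (vec a b) \<le> T"
  shows "\<bar>of_int a\<bar> \<le> coord_const * T" "\<bar>of_int b\<bar> \<le> coord_const * T"
  using coordinates_bounded[where a = a and b = b] mult_left_mono[OF assms coord_const_nonneg]
  by (auto intro: order.trans)

lemma finite_ball_L: "finite {v \<in> L. norm v \<le> T}"
proof (rule finite_subset)
  let ?n = "\<lceil>coord_const * T\<rceil>"
  show "{v \<in> L. norm v \<le> T} \<subseteq> (\<lambda>(a, b). vec a b) ` ({- ?n..?n} \<times> {- ?n..?n})"
  proof safe
    fix v assume "v \<in> L" "norm v \<le> T"
    then obtain a b where v: "v = vec a b" using vec_cases by blast
    have "\<bar>a\<bar> \<le> ?n" "\<bar>b\<bar> \<le> ?n"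
      using coordinates_le[where a = a and b = b and T = T] \<open>norm v \<le> T\<close> unfolding v by linarith+
    thus "v \<in> (\<lambda>(a, b). vec a b) ` ({- ?n..?n} \<times> {- ?n..?n})" unfolding v by force
  qed
qed simp

lemma L_prim_subset: "L_prim L T \<subseteq> {v \<in> L. norm v \<le> T}"
  by (auto simp: L_prim_def primitive_vector_def)

lemma finite_L_prim: "finite (L_prim L T)"
  using L_prim_subset finite_ball_L finite_subset by blast

lemma vec_in_L_prim_iff: "vec a b \<in> L_prim L T \<longleftrightarrow> coprime a b \<and> norm (vec a b) \<le> T"
  by (simp add: L_prim_def primitive_vector_vec_iff)

lemma card_L_prim_ge:
  assumes "2 * (norm w1 + norm w2) \<le> T"
  shows "real (card (L_prim L T)) \<ge> T\<^sup>2 / (16 * (norm w1 + norm w2)\<^sup>2)"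
proof -
  define s where "s = norm w1 + norm w2"
  have "w1 \<noteq> 0" using det_pos by auto
  hence s: "s > 0" by (simp add: s_def add_pos_nonneg)
  define n where "n = nat \<lfloor>T / s\<rfloor>"
  have Ts: "T / s \<ge> 2" using assms s by (simp add: s_def[symmetric] pos_le_divide_eq)
  hence n: "real n \<le> T / s" "T / s - 1 \<le> real n" unfolding n_def by linarith+
  let ?C = "{(a, b). a \<in> {1..n} \<and> b \<in> {1..n} \<and> coprime a b}"
  have "card ?C \<le> card (L_prim L T)"
  proof (rule card_inj_on_le[of "\<lambda>(a, b). vec (int a) (int b)"])
    show "inj_on (\<lambda>(a, b). vec (int a) (int b)) ?C" by (auto intro!: inj_onI simp: vec_eq_iff)
    show "(\<lambda>(a, b). vec (int a) (int b)) ` ?C \<subseteq> L_prim L T"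
    proof safe
      fix a b assume ab: "a \<in> {1..n}" "b \<in> {1..n}" "coprime a b"
      have "norm (vec (int a) (int b)) \<le> real a * norm w1 + real b * norm w2"
        unfolding vec_def by (rule order.trans[OF norm_triangle_ineq]) (simp add: norm_mult)
      also have "\<dots> \<le> real n * norm w1 + real n * norm w2"
        using ab by (intro add_mono mult_right_mono) auto
      also have "\<dots> = real n * s" by (simp add: s_def distrib_left)
      also have "\<dots> \<le> T" using n(1) s by (simp add: pos_le_divide_eq)
      finally show "vec (int a) (int b) \<in> L_prim L T" using ab by (simp add: vec_in_L_prim_iff)
    qed
  qed (rule finite_L_prim)
  hence "(real n)\<^sup>2 / 4 \<le> real (card (L_prim L T))" using card_coprime_pairs_ge[of n] by linarith
  moreover have "(T / s / 2)\<^sup>2 \<le> (real n)\<^sup>2" using n Ts by (intro power_mono) auto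
  moreover have "(T / s / 2)\<^sup>2 / 4 = T\<^sup>2 / (16 * s\<^sup>2)" by (simp add: power_divide)
  ultimately show ?thesis unfolding s_def by linarith
qed

lemma card_L_prim_at_top: "filterlim (\<lambda>T. real (card (L_prim L T))) at_top at_top"
proof (rule filterlim_at_top_mono)
  have "w1 \<noteq> 0" using det_pos by auto
  hence s: "norm w1 + norm w2 > 0" by (simp add: add_pos_nonneg)
  have "filterlim (\<lambda>T::real. T\<^sup>2 / c) at_top at_top" if "c > 0" for c :: real
    using that by real_asymp
  thus "filterlim (\<lambda>T. T\<^sup>2 / (16 * (norm w1 + norm w2)\<^sup>2)) at_top at_top" using s by simp
  show "\<forall>\<^sub>F T in at_top. T\<^sup>2 / (16 * (norm w1 + norm w2)\<^sup>2) \<le> real (card (L_prim L T))"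
    using eventually_ge_at_top[of "2 * (norm w1 + norm w2)"] by eventually_elim (rule card_L_prim_ge)
qed

text \<open>
  Adding or subtracting \<open>v\<close> gives other oriented completions, which are not shorter.
\<close>

lemma minimal_completion_Re:
  assumes "coprime a b" "minimal_completion L (vec a b) (vec c d)"
  shows "\<bar>Re (vec c d / vec a b)\<bar> \<le> 1/2"
proof -
  let ?v = "vec a b" and ?r = "vec c d / vec a b"
  have v0: "?v \<noteq> 0" using coprime_vec_neq_0 assms by simp
  have or: "oriented_completion L ?v (vec c d)" and mn: "\<And>y. oriented_completion L ?v y \<Longrightarrow> norm (vec c d) \<le> norm y"
    using assms(2) by (auto simp: minimal_completion_def is_arg_min_linorder)
  have shift: "(Re ?r)\<^sup>2 \<le> (Re ?r + of_int e)\<^sup>2" for e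
  proof -
    have "vec c d + of_int e * ?v = vec (c + e * a) (d + e * b)" by (simp add: vec_def algebra_simps)
    moreover have "oriented_completion L ?v (vec (c + e * a) (d + e * b))"
      using or unfolding oriented_completion_vec_iff[OF assms(1)] by (simp add: algebra_simps)
    ultimately have "norm (vec c d) \<le> norm (vec c d + of_int e * ?v)" using mn by metis
    hence "norm (vec c d) / norm ?v \<le> norm (vec c d + of_int e * ?v) / norm ?v" by (intro divide_right_mono) auto
    hence "norm ?r \<le> norm (?r + of_int e)" using v0 by (simp add: norm_divide[symmetric] add_divide_distrib)
    hence "(norm ?r)\<^sup>2 \<le> (norm (?r + of_int e))\<^sup>2" by (intro power_mono) auto
    thus ?thesis unfolding cmod_power2 by simp
  qed
  show ?thesis using shift[of 1] shift[of "-1"] by (simp add: power2_eq_square algebra_simps abs_le_iff)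
qed

text \<open>
  The sign of the signed ratio agrees with that of the real part of \<open>v'/v\<close>, so the two differ
  by \<open>|v'/v| - |Re (v'/v)|\<close> in absolute value.
\<close>

lemma signed_ratio_approx:
  assumes "Im (v' / v) > 0"
  shows "\<bar>signed_ratio v v' - Re (v' / v)\<bar> \<le> Im (v' / v)"
proof -
  let ?r = "v' / v"
  have r0: "?r \<noteq> 0" using assms by (metis less_irrefl zero_complex.sel(2))
  have le: "norm ?r \<le> \<bar>Re ?r\<bar> + Im ?r" using cmod_le[of ?r] assms by simp
  have ge: "\<bar>Re ?r\<bar> \<le> norm ?r" by (rule abs_Re_le_cmod)
  have "signed_ratio v v' = (if Re ?r > 0 then norm ?r else - norm ?r)"
    unfolding signed_ratio_def Arg_Re_pos norm_divide using r0 by simp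
  thus ?thesis using le ge by (auto simp: abs_if split: if_splits)
qed

text \<open>
  From \<open>a d - b c = 1\<close> it follows that \<open>a v' - c v = w2\<close>.
\<close>

lemma Re_ratio_approx:
  assumes "a \<noteq> 0" "coprime a b" "a * d - b * c = 1"
  shows "\<bar>Re (vec c d / vec a b) - of_int c / of_int a\<bar> \<le> norm w2 / norm (vec a b)"
proof -
  have v0: "vec a b \<noteq> 0" using coprime_vec_neq_0 assms by simp
  have "of_int a * vec c d - of_int c * vec a b = of_int (a * d - b * c) * w2"
    by (simp add: vec_def algebra_simps)
  hence "of_int a * vec c d = of_int c * vec a b + w2" using assms by (simp add: algebra_simps)
  hence "of_int a * vec c d / (of_int a * vec a b) = of_int c * vec a b / (of_int a * vec a b) + w2 / (of_int a * vec a b)"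
    by (simp only: add_divide_distrib)
  hence ratio: "vec c d / vec a b = of_int c / of_int a + w2 / (of_int a * vec a b)"
    using assms(1) v0 by simp
  have "Re (vec c d / vec a b) - of_int c / of_int a = Re (w2 / (of_int a * vec a b))"
  proof -
    have "complex_of_int c / of_int a = of_real (of_int c / of_int a)" by simp
    thus ?thesis unfolding ratio
      by (simp only: plus_complex.sel Re_complex_of_real add_diff_cancel_left')
  qed
  also have "\<bar>\<dots>\<bar> \<le> norm (w2 / (of_int a * vec a b))" by (rule abs_Re_le_cmod)
  also have "\<dots> = norm w2 / (\<bar>of_int a\<bar> * norm (vec a b))" by (simp add: norm_divide norm_mult)
  also have "\<dots> \<le> norm w2 / (1 * norm (vec a b))"
    using assms(1) v0 by (intro divide_left_mono mult_right_mono mult_pos_pos) auto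
  finally show ?thesis by simp
qed

end

section \<open>The signed ratio\<close>

lemma convex_int_set_is_interval:
  fixes S :: "int set"
  assumes fin: "finite S" and conv: "\<And>x y z. x \<in> S \<Longrightarrow> z \<in> S \<Longrightarrow> x \<le> y \<Longrightarrow> y \<le> z \<Longrightarrow> y \<in> S"
  shows "\<exists>l. S = {l..<l + int (card S)}"
proof (cases "S = {}")
  case False
  define m M where "m = Min S" and "M = Max S"
  have mM: "m \<in> S" "M \<in> S" "m \<le> M" using fin False by (simp_all add: m_def M_def)
  have S: "S = {m..M}"
  proof (intro equalityI subsetI)
    fix y assume "y \<in> S"
    thus "y \<in> {m..M}" using fin by (simp add: m_def M_def)
  next
    fix y assume "y \<in> {m..M}"
    thus "y \<in> S" using conv[OF mM(1,2)] by simp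
  qed
  have "int (card {m..M}) = M - m + 1" using mM(3) by simp
  hence "{m..M} = {m..<m + int (card {m..M})}" by auto
  thus ?thesis unfolding S by (rule exI)
qed simp

locale completed_lattice = oriented_lattice +
  fixes compl :: "complex \<Rightarrow> complex" and \<rho> :: "complex \<Rightarrow> real"
  assumes compl: "\<And>v. primitive_vector L v \<Longrightarrow> minimal_completion L v (compl v)"
    and rho: "\<And>v. primitive_vector L v \<Longrightarrow> \<rho> v = signed_ratio v (compl v)"
begin

text \<open>
  The first coordinate of a lattice vector, recovered from a signed area.
\<close>

definition coord :: "complex \<Rightarrow> int" where
  "coord v = \<lfloor>Im (cnj v * w2) / covol\<rfloor>"

lemma coord_vec [simp]: "coord (vec a b) = a"
proof -
  have "vec 0 1 = w2" by (simp add: vec_def)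
  hence "Im (cnj (vec a b) * w2) = of_int a * covol" using Im_cnj_vec_mult_vec[of a b 0 1] by simp
  thus ?thesis using covol_pos by (simp add: coord_def)
qed

lemma primitive_cases:
  assumes "primitive_vector L v"
  obtains a b c d where "v = vec a b" "compl v = vec c d" "coprime a b" "a * d - b * c = 1"
    "minimal_completion L (vec a b) (vec c d)"
proof -
  have "v \<in> L" using assms by (simp add: primitive_vector_def)
  then obtain a b where v: "v = vec a b" by (rule vec_cases)
  have cop: "coprime a b" using assms by (simp add: v primitive_vector_vec_iff)
  have mc: "minimal_completion L v (compl v)" by (rule compl[OF assms])
  hence or: "oriented_completion L v (compl v)" by (simp add: minimal_completion_def is_arg_min_linorder)
  hence "compl v \<in> L" by (simp add: oriented_completion_def)
  then obtain c d where c: "compl v = vec c d" by (rule vec_cases)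
  have "a * d - b * c = 1" using or oriented_completion_vec_iff[OF cop] by (simp add: v c[unfolded v])
  thus ?thesis using that[of a b c d] v c cop mc by simp
qed

lemma rho_near_Re:
  assumes "primitive_vector L v"
  shows "\<bar>\<rho> v - Re (compl v / v)\<bar> \<le> covol / (norm v)\<^sup>2"
proof -
  obtain a b c d where v: "v = vec a b" "compl v = vec c d" "coprime a b" "a * d - b * c = 1"
    using primitive_cases[OF assms] by metis
  have Im: "Im (compl v / v) = covol / (norm v)\<^sup>2" unfolding v(2) unfolding v(1) Im_vec_divide v(4) by simp
  also have "\<dots> > 0" using covol_pos coprime_vec_neq_0[OF v(3)] v(1) by simp
  finally have "\<bar>signed_ratio v (compl v) - Re (compl v / v)\<bar> \<le> Im (compl v / v)" by (rule signed_ratio_approx)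
  thus ?thesis using rho[OF assms] Im by simp
qed

lemma rho_abs_le:
  assumes "primitive_vector L v"
  shows "\<bar>\<rho> v\<bar> \<le> 1/2 + covol / (norm v)\<^sup>2"
proof -
  obtain a b c d where v: "v = vec a b" "compl v = vec c d" "coprime a b" "minimal_completion L (vec a b) (vec c d)"
    using primitive_cases[OF assms] by metis
  have "\<bar>Re (compl v / v)\<bar> \<le> 1/2" unfolding v(2) unfolding v(1) by (rule minimal_completion_Re[OF v(3,4)])
  thus ?thesis using rho_near_Re[OF assms] by linarith
qed

definition coord_ratio :: "complex \<Rightarrow> real" where
  "coord_ratio v = of_int (coord (compl v)) / of_int (coord v)"

lemma rho_near_coord_ratio:
  assumes "primitive_vector L v" "coord v \<noteq> 0"
  shows "\<bar>\<rho> v - coord_ratio v\<bar> \<le> covol / (norm v)\<^sup>2 + norm w2 / norm v"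
proof -
  obtain a b c d where v: "v = vec a b" "compl v = vec c d" "coprime a b" "a * d - b * c = 1"
    using primitive_cases[OF assms(1)] by metis
  have a: "a \<noteq> 0" using assms(2) by (simp add: v(1))
  have "coord_ratio v = of_int c / of_int a" unfolding coord_ratio_def v(2) by (simp add: v(1))
  moreover have "\<bar>Re (compl v / v) - of_int c / of_int a\<bar> \<le> norm w2 / norm v"
    unfolding v(2) unfolding v(1) by (rule Re_ratio_approx[OF a v(3,4)])
  ultimately show ?thesis using rho_near_Re[OF assms(1)] by linarith
qed

lemma finite_primitive_far:
  assumes h: "(h \<longlongrightarrow> 0) at_top" and "\<epsilon> > 0"
  shows "finite {v \<in> (\<Union>T. L_prim L T). h (norm v) > (\<epsilon>::real)}"
proof -
  have "eventually (\<lambda>x. h x < \<epsilon>) at_top" using order_tendstoD(2)[OF h assms(2)] .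
  then obtain R where R: "\<And>x. x \<ge> R \<Longrightarrow> h x < \<epsilon>" by (auto simp: eventually_at_top_linorder)
  have "{v \<in> (\<Union>T. L_prim L T). h (norm v) > \<epsilon>} \<subseteq> {v \<in> L. norm v \<le> R}"
  proof (rule subsetI)
    fix v assume v: "v \<in> {v \<in> (\<Union>T. L_prim L T). h (norm v) > \<epsilon>}"
    hence "v \<in> L" using L_prim_subset by blast
    moreover have "norm v \<le> R" using R[of "norm v"] v by force
    ultimately show "v \<in> {v \<in> L. norm v \<le> R}" by simp
  qed
  thus ?thesis using finite_ball_L finite_subset by blast
qed

lemma L_prim_primitive: "v \<in> L_prim L T \<Longrightarrow> primitive_vector L v"
  by (simp add: L_prim_def)

text \<open>
  The exponential with \<open>\<rho> v\<close> replaced by the rational number \<open>c/a\<close>; the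
  vectors with \<open>a = 0\<close> are discarded.
\<close>

definition rational_term :: "nat \<Rightarrow> complex \<Rightarrow> complex" where
  "rational_term k v = (if coord v = 0 then 0 else circ (coord_ratio v) ^ k)"

text \<open>
  The difference of the exponentials tends to zero as the norm of \<open>v\<close> grows, hence so does its
  average.
\<close>

lemma weyl_term_replace:
  "((\<lambda>T. (\<Sum>v\<in>L_prim L T. circ (\<rho> v) ^ k - rational_term k v) / of_nat (card (L_prim L T))) \<longlongrightarrow> 0) at_top"
proof (rule average_null_tendsto[OF card_L_prim_at_top finite_L_prim])
  fix \<epsilon> :: real assume \<epsilon>: "\<epsilon> > 0"
  define h where "h x = 2 * pi * (real k * (covol / x\<^sup>2 + norm w2 / x))" for x :: real
  have h0: "(h \<longlongrightarrow> 0) at_top" unfolding h_def by real_asymp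
  have "{v \<in> (\<Union>T. L_prim L T). norm (circ (\<rho> v) ^ k - rational_term k v) > \<epsilon>} \<subseteq>
     {vec 0 1, vec 0 (-1)} \<union> {v \<in> (\<Union>T. L_prim L T). h (norm v) > \<epsilon>}"
  proof (rule subsetI)
    fix v assume v: "v \<in> {v \<in> (\<Union>T. L_prim L T). norm (circ (\<rho> v) ^ k - rational_term k v) > \<epsilon>}"
    hence prim: "primitive_vector L v" using L_prim_primitive by blast
    show "v \<in> {vec 0 1, vec 0 (-1)} \<union> {v \<in> (\<Union>T. L_prim L T). h (norm v) > \<epsilon>}"
    proof (cases "coord v = 0")
      case True
      obtain a b c d where ab: "v = vec a b" "coprime a b" using primitive_cases[OF prim] by metis
      hence "a = 0" "\<bar>b\<bar> = 1" using True by auto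
      hence "b = 1 \<or> b = -1" by linarith
      thus ?thesis using ab \<open>a = 0\<close> by auto
    next
      case False
      have "norm (circ (\<rho> v) ^ k - rational_term k v) = norm (circ (real k * \<rho> v) - circ (real k * coord_ratio v))"
        using False by (simp add: rational_term_def circ_power)
      also have "\<dots> \<le> 2 * pi * \<bar>real k * \<rho> v - real k * coord_ratio v\<bar>" by (rule norm_circ_diff_le)
      also have "\<dots> = 2 * pi * (real k * \<bar>\<rho> v - coord_ratio v\<bar>)" by (simp add: right_diff_distrib[symmetric] abs_mult)
      also have "\<dots> \<le> h (norm v)" unfolding h_def
        using rho_near_coord_ratio[OF prim False] by (intro mult_left_mono) auto
      finally show ?thesis using v by auto
    qed
  qed
  moreover have "finite ({vec 0 1, vec 0 (-1)} \<union> {v \<in> (\<Union>T. L_prim L T). h (norm v) > \<epsilon>})"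
    using finite_primitive_far[OF h0 \<epsilon>] by simp
  ultimately show "finite {v \<in> (\<Union>T. L_prim L T). norm (circ (\<rho> v) ^ k - rational_term k v) > \<epsilon>}"
    by (rule finite_subset)
qed

text \<open>
  Since \<open>c\<close> is minus an inverse of \<open>b\<close>, the frequency changes its sign with the
  sign of \<open>a\<close> when the modulus is made positive.
\<close>

definition inverse_term :: "nat \<Rightarrow> int \<Rightarrow> int \<Rightarrow> complex" where
  "inverse_term k a b = (if a > 0 then inverse_char a (- int k) b else if a < 0 then inverse_char (- a) (int k) b else 0)"

lemma rational_term_vec:
  assumes "coprime a b"
  shows "rational_term k (vec a b) = inverse_term k a b"
proof (cases "a = 0")
  case True thus ?thesis by (simp add: rational_term_def inverse_term_def)
next
  case False
  have prim: "primitive_vector L (vec a b)" using assms by (simp add: primitive_vector_vec_iff)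
  obtain c d where c: "compl (vec a b) = vec c d" "a * d - b * c = 1"
    using primitive_cases[OF prim] by (metis vec_eq_iff)
  have kt: "rational_term k (vec a b) = circ (real k * (of_int c / of_int a))"
    using False by (simp add: rational_term_def coord_ratio_def c(1) circ_power)
  have cong: "[modular_inverse q b = - c] (mod q)" if "q dvd a" for q
  proof (rule modular_inverse_cong_unique)
    have "b * (- c) - 1 = - (a * d)" using c(2) by simp
    hence "q dvd b * (- c) - 1" using that by simp
    thus "[b * (- c) = 1] (mod q)" by (simp add: cong_iff_dvd_diff)
  qed
  have cop: "coprime b a" "coprime b (- a)" using assms by (simp_all add: coprime_commute)
  consider "a > 0" | "a < 0" using False by linarith
  thus ?thesis
  proof cases
    case 1
    have "chi a (- int k * modular_inverse a b) = chi a (- int k * (- c))"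
      by (intro chi_cong cong_mult cong_refl cong) simp
    thus ?thesis using 1 cop kt by (simp add: inverse_term_def inverse_char_def chi_def)
  next
    case 2
    have "chi (- a) (int k * modular_inverse (- a) b) = chi (- a) (int k * (- c))"
      by (intro chi_cong cong_mult cong_refl cong) simp
    thus ?thesis using 2 cop kt by (simp add: inverse_term_def inverse_char_def chi_def)
  qed
qed

lemma inverse_term_nonzero_imp_coprime: "inverse_term k a b \<noteq> 0 \<Longrightarrow> coprime a b"
  by (auto simp: inverse_term_def inverse_char_def coprime_commute split: if_splits)

definition slice :: "real \<Rightarrow> int \<Rightarrow> int set" where
  "slice T a = {b. norm (vec a b) \<le> T}"

text \<open>
  One bound for the coordinates and for the number of elements of a slice; the summand \<open>2\<close>
  makes it positive and absorbs the rounding.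
\<close>

definition range_bound :: "real \<Rightarrow> nat" where
  "range_bound T = nat \<lceil>2 * coord_const * T\<rceil> + 2"

lemma slice_subset: "slice T a \<subseteq> {- \<lfloor>coord_const * T\<rfloor>..\<lfloor>coord_const * T\<rfloor>}"
proof (rule subsetI)
  fix b assume "b \<in> slice T a"
  hence "\<bar>of_int b\<bar> \<le> coord_const * T"
    using coordinates_le(2)[where a = a and b = b and T = T] by (simp add: slice_def)
  thus "b \<in> {- \<lfloor>coord_const * T\<rfloor>..\<lfloor>coord_const * T\<rfloor>}" by (simp, linarith)
qed

lemma finite_slice: "finite (slice T a)"
  using slice_subset finite_subset by blast

lemma card_slice_le: assumes "T \<ge> 0" shows "card (slice T a) \<le> range_bound T"
proof -
  have "card (slice T a) \<le> card {- \<lfloor>coord_const * T\<rfloor>..\<lfloor>coord_const * T\<rfloor>}"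
    by (intro card_mono slice_subset) simp
  also have "\<dots> = nat (2 * \<lfloor>coord_const * T\<rfloor> + 1)" by simp
  also have "\<dots> \<le> range_bound T" unfolding range_bound_def mult.assoc by linarith
  finally show ?thesis .
qed

text \<open>
  A slice is the intersection of a line with the disc of radius \<open>T\<close>, which is convex.
\<close>

lemma slice_interval: "\<exists>l. slice T a = {l..<l + int (card (slice T a))}"
proof (rule convex_int_set_is_interval[OF finite_slice])
  fix x y z assume xz: "x \<in> slice T a" "z \<in> slice T a" and le: "x \<le> y" "y \<le> z"
  show "y \<in> slice T a"
  proof (cases "x = z")
    case True thus ?thesis using xz le by simp
  next
    case False
    define t where "t = (of_int (y - x) / of_int (z - x) :: real)"
    have t: "0 \<le> t" "t \<le> 1" using le False by (simp_all add: t_def)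
    have zx: "complex_of_int (z - x) \<noteq> 0" using False by simp
    have "of_real t * complex_of_int (z - x) = of_int (y - x)" using zx by (simp add: t_def)
    hence y: "complex_of_int y = of_int x + of_real t * (of_int z - of_int x)" by (simp add: algebra_simps)
    have "vec a y = (1 - t) *\<^sub>R vec a x + t *\<^sub>R vec a z"
      unfolding vec_def y by (simp add: scaleR_conv_of_real algebra_simps)
    also have "\<dots> \<in> cball 0 T"
      using xz t by (intro convexD_alt convex_cball) (auto simp: slice_def)
    finally show ?thesis by (simp add: slice_def)
  qed
qed

lemma sum_rational_term_eq:
  assumes "T \<ge> 0"
  shows "(\<Sum>v\<in>L_prim L T. rational_term k v) =
    (\<Sum>a\<in>{- int (range_bound T)..int (range_bound T)}. \<Sum>b\<in>slice T a. inverse_term k a b)"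
proof -
  let ?A = "{- int (range_bound T)..int (range_bound T)}"
  let ?P = "{(a, b). coprime a b \<and> norm (vec a b) \<le> T}"
  have sub: "?P \<subseteq> Sigma ?A (slice T)"
  proof safe
    fix a b assume "norm (vec a b) \<le> T"
    hence "\<bar>of_int a\<bar> \<le> coord_const * T" by (rule coordinates_le(1))
    also have "\<dots> \<le> 2 * coord_const * T" using coord_const_nonneg assms by simp
    finally show "a \<in> ?A" by (simp add: range_bound_def, linarith)
  qed (simp add: slice_def)
  have "bij_betw (\<lambda>(a, b). vec a b) ?P (L_prim L T)"
    unfolding bij_betw_def
  proof
    show "inj_on (\<lambda>(a, b). vec a b) ?P" by (auto intro!: inj_onI simp: vec_eq_iff)
    show "(\<lambda>(a, b). vec a b) ` ?P = L_prim L T"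
    proof (intro equalityI subsetI)
      fix v assume v: "v \<in> L_prim L T"
      then obtain a b where ab: "v = vec a b" using L_prim_subset vec_cases by blast
      hence "(a, b) \<in> ?P" using v by (simp add: vec_in_L_prim_iff)
      thus "v \<in> (\<lambda>(a, b). vec a b) ` ?P" using ab by force
    qed (auto simp: vec_in_L_prim_iff)
  qed
  hence "(\<Sum>v\<in>L_prim L T. rational_term k v) = (\<Sum>p\<in>?P. rational_term k (case p of (a, b) \<Rightarrow> vec a b))"
    by (rule sum.reindex_bij_betw[symmetric])
  also have "\<dots> = (\<Sum>(a, b)\<in>?P. inverse_term k a b)" by (intro sum.cong) (auto simp: rational_term_vec)
  also have "\<dots> = (\<Sum>(a, b)\<in>Sigma ?A (slice T). inverse_term k a b)"
    by (rule sum.mono_neutral_left) (use sub finite_slice in \<open>auto simp: slice_def dest: inverse_term_nonzero_imp_coprime\<close>)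
  also have "\<dots> = (\<Sum>a\<in>?A. \<Sum>b\<in>slice T a. inverse_term k a b)"
    by (rule sum.Sigma[symmetric]) (auto simp: finite_slice)
  finally show ?thesis .
qed

lemma range_bound_at_top: "filterlim range_bound at_top at_top"
proof -
  have "w1 \<noteq> 0" using det_pos by auto
  hence "coord_const > 0" using covol_pos by (simp add: coord_const_def add_pos_nonneg)
  hence "filterlim (\<lambda>T. 2 * coord_const * T) at_top at_top" by real_asymp
  hence ev: "eventually (\<lambda>T. real Z \<le> 2 * coord_const * T) at_top" for Z
    unfolding filterlim_at_top by blast
  show ?thesis unfolding filterlim_at_top
  proof
    fix Z show "\<forall>\<^sub>F T in at_top. Z \<le> range_bound T"
      using ev[of Z] by eventually_elim (simp add: range_bound_def, linarith)
  qed
qed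

lemma range_bound_le_card:
  obtains \<kappa> where "\<kappa> > 0" "eventually (\<lambda>T. \<kappa> * (real (range_bound T))\<^sup>2 \<le> real (card (L_prim L T))) at_top"
proof
  define s where "s = norm w1 + norm w2"
  have "w1 \<noteq> 0" using det_pos by auto
  hence s: "s > 0" by (simp add: s_def add_pos_nonneg)
  define B where "B = 2 * coord_const + 3"
  have B: "B > 0" using coord_const_nonneg by (simp add: B_def)
  show "1 / (16 * s\<^sup>2 * B\<^sup>2) > 0" using s B by simp
  show "eventually (\<lambda>T. 1 / (16 * s\<^sup>2 * B\<^sup>2) * (real (range_bound T))\<^sup>2 \<le> real (card (L_prim L T))) at_top"
    using eventually_ge_at_top[of "2 * s"] eventually_ge_at_top[of 1]
  proof eventually_elim
    case (elim T)
    have "0 \<le> 2 * coord_const * T" using coord_const_nonneg elim by simp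
    hence "real (range_bound T) \<le> 2 * coord_const * T + 3" unfolding range_bound_def by linarith
    also have "\<dots> \<le> B * T" using elim by (simp add: B_def distrib_right)
    finally have "(real (range_bound T))\<^sup>2 \<le> (B * T)\<^sup>2" by (intro power_mono) auto
    hence "1 / (16 * s\<^sup>2 * B\<^sup>2) * (real (range_bound T))\<^sup>2 \<le> 1 / (16 * s\<^sup>2 * B\<^sup>2) * (B * T)\<^sup>2"
      using s B by (intro mult_left_mono) auto
    also have "\<dots> = T\<^sup>2 / (16 * s\<^sup>2)" using B by (simp add: power_mult_distrib)
    also have "\<dots> \<le> real (card (L_prim L T))" using card_L_prim_ge[of T] elim by (simp add: s_def)
    finally show ?case .
  qed
qed

text \<open>
  The slices with positive and with negative first coordinate contribute incomplete Kloosterman sums with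
  the frequencies \<open>-k\<close> and \<open>k\<close>. The average over the moduli is
  \<open>o(T^2)\<close>, and the number of primitive vectors is at least a constant times
  \<open>T^2\<close>.
\<close>

lemma rational_term_average:
  assumes k: "k > 0"
  shows "((\<lambda>T. (\<Sum>v\<in>L_prim L T. rational_term k v) / of_nat (card (L_prim L T))) \<longlongrightarrow> 0) at_top"
proof -
  obtain E1 where E1: "(\<lambda>M. E1 M / (real M)\<^sup>2) \<longlonglongrightarrow> 0"
    "\<And>M l N. (\<And>q. 0 \<le> N q \<and> N q \<le> int M) \<Longrightarrow> M > 0 \<Longrightarrow>
      (\<Sum>q\<in>{1..int M}. norm (\<Sum>b\<in>{l q..<l q + N q}. inverse_char q (- int k) b)) \<le> E1 M"
    using inverse_char_sums_average[of "- int k"] k by auto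
  obtain E2 where E2: "(\<lambda>M. E2 M / (real M)\<^sup>2) \<longlonglongrightarrow> 0"
    "\<And>M l N. (\<And>q. 0 \<le> N q \<and> N q \<le> int M) \<Longrightarrow> M > 0 \<Longrightarrow>
      (\<Sum>q\<in>{1..int M}. norm (\<Sum>b\<in>{l q..<l q + N q}. inverse_char q (int k) b)) \<le> E2 M"
    using inverse_char_sums_average[of "int k"] k by auto
  have bound: "norm (\<Sum>v\<in>L_prim L T. rational_term k v) \<le> E1 (range_bound T) + E2 (range_bound T)" if T: "T \<ge> 0" for T
  proof -
    define M where "M = range_bound T"
    have M: "M > 0" by (simp add: M_def range_bound_def)
    obtain l where l: "\<And>a. slice T a = {l a..<l a + int (card (slice T a))}" using slice_interval by metis
    define F where "F a = norm (\<Sum>b\<in>slice T a. inverse_term k a b)" for a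
    have split: "{- int M..int M} = uminus ` {1..int M} \<union> ({0} \<union> {1..int M})"
      by (auto simp: image_iff)
    have "norm (\<Sum>v\<in>L_prim L T. rational_term k v) \<le> (\<Sum>a\<in>{- int M..int M}. F a)"
      unfolding sum_rational_term_eq[OF T] M_def F_def by (rule norm_sum)
    also have "\<dots> = (\<Sum>a\<in>uminus ` {1..int M}. F a) + (F 0 + (\<Sum>a\<in>{1..int M}. F a))"
      unfolding split by (subst sum.union_disjoint) auto
    also have "F 0 = 0" by (simp add: F_def inverse_term_def)
    also have "(\<Sum>a\<in>uminus ` {1..int M}. F a) = (\<Sum>q\<in>{1..int M}. F (- q))"
      by (subst sum.reindex) (auto simp: inj_on_def)
    also have "(\<Sum>q\<in>{1..int M}. F (- q)) =
        (\<Sum>q\<in>{1..int M}. norm (\<Sum>b\<in>{l (- q)..<l (- q) + int (card (slice T (- q)))}. inverse_char q (int k) b))"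
      unfolding l[symmetric] by (intro sum.cong refl) (auto simp: F_def inverse_term_def)
    also have "\<dots> \<le> E2 M"
      using card_slice_le[OF T] M by (intro E2(2)) (auto simp: M_def)
    also have "(\<Sum>q\<in>{1..int M}. F q) =
        (\<Sum>q\<in>{1..int M}. norm (\<Sum>b\<in>{l q..<l q + int (card (slice T q))}. inverse_char q (- int k) b))"
      unfolding l[symmetric] by (intro sum.cong refl) (auto simp: F_def inverse_term_def)
    also have "\<dots> \<le> E1 M"
      using card_slice_le[OF T] M by (intro E1(2)) (auto simp: M_def)
    finally show ?thesis by (simp add: M_def)
  qed
  obtain \<kappa> where \<kappa>: "\<kappa> > 0" "eventually (\<lambda>T. \<kappa> * (real (range_bound T))\<^sup>2 \<le> real (card (L_prim L T))) at_top"
    by (rule range_bound_le_card)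
  have "(\<lambda>M. (E1 M / (real M)\<^sup>2 + E2 M / (real M)\<^sup>2) / \<kappa>) \<longlonglongrightarrow> (0 + 0) / \<kappa>"
    by (intro tendsto_intros E1(1) E2(1)) (use \<kappa> in auto)
  from filterlim_compose[OF this range_bound_at_top]
  have lim: "((\<lambda>T. (E1 (range_bound T) / (real (range_bound T))\<^sup>2 + E2 (range_bound T) / (real (range_bound T))\<^sup>2) / \<kappa>) \<longlongrightarrow> 0) at_top"
    by simp
  show ?thesis
  proof (rule Lim_null_comparison[OF _ lim])
    show "\<forall>\<^sub>F T in at_top. norm ((\<Sum>v\<in>L_prim L T. rational_term k v) / of_nat (card (L_prim L T))) \<le>
       (E1 (range_bound T) / (real (range_bound T))\<^sup>2 + E2 (range_bound T) / (real (range_bound T))\<^sup>2) / \<kappa>"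
      using \<kappa>(2) eventually_ge_at_top[of 0]
    proof eventually_elim
      case (elim T)
      let ?M = "real (range_bound T)"
      have M: "?M > 0" by (simp add: range_bound_def)
      have "norm ((\<Sum>v\<in>L_prim L T. rational_term k v) / of_nat (card (L_prim L T))) =
          norm (\<Sum>v\<in>L_prim L T. rational_term k v) / real (card (L_prim L T))" by (simp add: norm_divide)
      also have "\<dots> \<le> norm (\<Sum>v\<in>L_prim L T. rational_term k v) / (\<kappa> * ?M\<^sup>2)"
      proof -
        have "0 < \<kappa> * ?M\<^sup>2" using \<kappa>(1) M by simp
        moreover from this have "0 < real (card (L_prim L T))" using elim(1) by linarith
        ultimately show ?thesis using elim(1) M \<kappa>(1) by (intro divide_left_mono mult_pos_pos) auto
      qed
      also have "\<dots> \<le> (E1 (range_bound T) + E2 (range_bound T)) / (\<kappa> * ?M\<^sup>2)"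
        using \<kappa>(1) by (intro divide_right_mono bound elim) auto
      also have "\<dots> = (E1 (range_bound T) / ?M\<^sup>2 + E2 (range_bound T) / ?M\<^sup>2) / \<kappa>"
        by (simp add: add_divide_distrib mult.commute)
      finally show ?case .
    qed
  qed
qed

lemma weyl_sums_rho:
  assumes "k > 0"
  shows "((\<lambda>T. (\<Sum>v\<in>L_prim L T. circ (\<rho> v) ^ k) / of_nat (card (L_prim L T))) \<longlongrightarrow> 0) at_top"
  using tendsto_add[OF weyl_term_replace[of k] rational_term_average[OF assms]]
  by (simp add: sum_subtractf diff_divide_distrib)

sublocale weyl_family "L_prim L" \<rho>
  by unfold_locales (fact finite_L_prim card_L_prim_at_top weyl_sums_rho)+

lemma uniformly_distributed_rho: "uniformly_distributed_mod_1 L \<rho>"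
  unfolding uniformly_distributed_mod_1_def
proof (intro allI impI)
  fix a b :: real assume ab: "0 \<le> a \<and> a < b \<and> b \<le> 1"
  show "((\<lambda>T. real (card {v \<in> L_prim L T. a \<le> frac (\<rho> v) \<and> frac (\<rho> v) < b}) / real (card (L_prim L T))) \<longlongrightarrow> b - a) at_top"
  proof (rule proportion_tendsto)
    fix v assume "a \<le> frac (\<rho> v) \<and> frac (\<rho> v) < b"
    thus "in_arc a b (\<rho> v)" unfolding in_arc_def frac_def by (intro exI[of _ "- \<lfloor>\<rho> v\<rfloor>"]) simp
  next
    fix \<epsilon> :: real assume \<epsilon>: "\<epsilon> > 0"
    have "in_arc (b - \<epsilon>) (a + 1) (\<rho> v)" if "\<not> (a \<le> frac (\<rho> v) \<and> frac (\<rho> v) < b)" for v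
    proof (cases "frac (\<rho> v) < a")
      case True
      have "frac (\<rho> v) \<ge> 0" by simp
      thus ?thesis unfolding in_arc_def using True ab \<epsilon>
        by (intro exI[of _ "1 - \<lfloor>\<rho> v\<rfloor>"]) (simp add: frac_def, linarith)
    next
      case False
      hence "b \<le> frac (\<rho> v)" "frac (\<rho> v) < 1" using that frac_lt_1 by auto
      hence "b - \<epsilon> \<le> \<rho> v + of_int (- \<lfloor>\<rho> v\<rfloor>)" "\<rho> v + of_int (- \<lfloor>\<rho> v\<rfloor>) \<le> a + 1"
        using ab \<epsilon> unfolding frac_def by simp_all
      thus ?thesis unfolding in_arc_def by blast
    qed
    hence "{v \<in> (\<Union>T. L_prim L T). \<not> (a \<le> frac (\<rho> v) \<and> frac (\<rho> v) < b) \<and> \<not> in_arc (b - \<epsilon>) (a + 1) (\<rho> v)} = {}"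
      by blast
    thus "finite {v \<in> (\<Union>T. L_prim L T). \<not> (a \<le> frac (\<rho> v) \<and> frac (\<rho> v) < b) \<and> \<not> in_arc (b - \<epsilon>) (a + 1) (\<rho> v)}"
      by (simp only: finite.emptyI)
  qed (use ab in auto)
qed

text \<open>
  The value \<open>\<rho> v\<close> exceeds \<open>1/2\<close> in absolute value by at most the covolume
  over the square of the norm of \<open>v\<close>. So apart from finitely many \<open>v\<close>, a value
  outside the interval lies in the complementary arc enlarged by \<open>\<epsilon>\<close>, also when
  \<open>\<beta> = 1/2\<close> and the value is slightly below \<open>-1/2\<close>.
\<close>

lemma interval_proportion_rho:
  assumes "- 1 / 2 < \<alpha>" "\<alpha> \<le> \<beta>" "\<beta> \<le> 1 / 2"
  shows "((\<lambda>T. real (card {v \<in> L_prim L T. \<alpha> < \<rho> v \<and> \<rho> v < \<beta>}) / real (card (L_prim L T))) \<longlongrightarrow> \<beta> - \<alpha>) at_top"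
proof (rule proportion_tendsto)
  fix v assume "\<alpha> < \<rho> v \<and> \<rho> v < \<beta>"
  thus "in_arc \<alpha> \<beta> (\<rho> v)" unfolding in_arc_def by (intro exI[of _ 0]) simp
next
  fix \<epsilon> :: real assume \<epsilon>: "\<epsilon> > 0"
  \<comment> \<open>The second bound keeps \<open>1/2 + \<delta>\<close> below the end \<open>\<alpha> + 1\<close> of the complementary arc.\<close>
  define \<delta> where "\<delta> = min \<epsilon> (\<alpha> + 1 / 2)"
  have \<delta>: "\<delta> > 0" "\<delta> \<le> \<epsilon>" "\<delta> \<le> \<alpha> + 1 / 2" using \<epsilon> assms by (auto simp: \<delta>_def)
  have lim: "((\<lambda>x. covol / x\<^sup>2) \<longlongrightarrow> 0) at_top" by real_asymp
  have "{v \<in> (\<Union>T. L_prim L T). \<not> (\<alpha> < \<rho> v \<and> \<rho> v < \<beta>) \<and> \<not> in_arc (\<beta> - \<epsilon>) (\<alpha> + 1) (\<rho> v)} \<subseteq>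
    {v \<in> (\<Union>T. L_prim L T). covol / (norm v)\<^sup>2 > \<delta>}"
  proof (rule subsetI)
    fix v assume v: "v \<in> {v \<in> (\<Union>T. L_prim L T). \<not> (\<alpha> < \<rho> v \<and> \<rho> v < \<beta>) \<and> \<not> in_arc (\<beta> - \<epsilon>) (\<alpha> + 1) (\<rho> v)}"
    hence le: "\<bar>\<rho> v\<bar> \<le> 1/2 + covol / (norm v)\<^sup>2" using rho_abs_le L_prim_primitive by blast
    have "\<not> covol / (norm v)\<^sup>2 \<le> \<delta>"
    proof
      assume "covol / (norm v)\<^sup>2 \<le> \<delta>"
      hence r: "\<bar>\<rho> v\<bar> \<le> 1/2 + \<delta>" using le by linarith
      have "in_arc (\<beta> - \<epsilon>) (\<alpha> + 1) (\<rho> v)"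
      proof (cases "\<rho> v \<ge> \<beta>")
        case True
        thus ?thesis unfolding in_arc_def using r \<delta> \<epsilon> by (intro exI[of _ 0]) auto
      next
        case False
        hence "\<rho> v \<le> \<alpha>" using v by auto
        thus ?thesis unfolding in_arc_def using r \<delta> assms by (intro exI[of _ 1]) auto
      qed
      thus False using v by blast
    qed
    thus "v \<in> {v \<in> (\<Union>T. L_prim L T). covol / (norm v)\<^sup>2 > \<delta>}" using v by auto
  qed
  thus "finite {v \<in> (\<Union>T. L_prim L T). \<not> (\<alpha> < \<rho> v \<and> \<rho> v < \<beta>) \<and> \<not> in_arc (\<beta> - \<epsilon>) (\<alpha> + 1) (\<rho> v)}"
    using finite_primitive_far[OF lim \<delta>(1)] finite_subset by blast
qed (use assms in auto)

end

theorem theorem1p1: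
  fixes L :: "complex set" and compl :: "complex \<Rightarrow> complex" and \<rho> :: "complex \<Rightarrow> real"
  assumes "complex_lattice L"
    and "\<And>v. primitive_vector L v \<Longrightarrow> minimal_completion L v (compl v)"
    and "\<And>v. primitive_vector L v \<Longrightarrow> \<rho> v = signed_ratio v (compl v)"
  shows "uniformly_distributed_mod_1 L \<rho> \<and>
    (\<forall>\<alpha> \<beta>. - 1 / 2 < \<alpha> \<and> \<alpha> \<le> \<beta> \<and> \<beta> \<le> 1 / 2 \<longrightarrow>
      ((\<lambda>T. real (card {v \<in> L_prim L T. \<alpha> < \<rho> v \<and> \<rho> v < \<beta>})
             / real (card (L_prim L T))) \<longlongrightarrow> \<beta> - \<alpha>) at_top)"
proof -
  obtain w1 w2 where w: "Im (cnj w1 * w2) > 0" "L = {of_int a * w1 + of_int b * w2 | a b. True}"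
    by (rule lattice_has_reduced_basis[OF assms(1)])
  interpret completed_lattice L w1 w2 compl \<rho>
    by unfold_locales (use w assms in auto)
  show ?thesis using uniformly_distributed_rho interval_proportion_rho by blast
qed

end
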